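(* Suppose $\mathcal{T}=(V,E)$ is a countably infinite rooted and leafless directed tree, $\boldsymbol\lambda=\{\lambda_v\}_{v\in V^\circ}\subseteq(0,\infty)$, and the weighted shift $S_{\boldsymbol\lambda}$ on $\mathcal{T}$ with weights $\boldsymbol\lambda$ is a bounded operator on $\ell^2(V)$. If $r_2^{\mathscr{P}}(S_{\boldsymbol\lambda})>0$ for every path $\mathscr{P}$ in $\mathcal{T}$, then $S_{\boldsymbol\lambda}$ is reflexive.
   Context: $\mathbb{N}_0=\{0,1,2,\dots\}$. A directed tree $\mathcal{T}=(V,E)$ is a directed graph with nonempty vertex set $V$ and edge set $E\subseteq\{(u,v)\in V\times V\colon u\ne v\}$ which is connected (as an undirected graph), has no directed circuits, and in which every $v\in V$ has at most one parent, i.e. a vertex $\mathsf{par}(v)$ with $(\mathsf{par}(v),v)\in E$. Put $\mathsf{Chi}(u)=\{v\in V\colon (u,v)\in E\}$. A root is a vertex without parent (unique if it exists, denoted $\mathsf{root}$); $\mathcal{T}$ is rooted if the root exists, and then $V^\circ=V\setminus\{\mathsf{root}\}$. $\mathcal{T}$ is leafless if $\mathsf{Chi}(v)\neq\emptyset$ for all $v\in V$. $\mathsf{par}^k$ is the $k$-fold composition of $\mathsf{par}$ ($\mathsf{par}^0$ is the identity). For rooted $\mathcal{T}$ and $v\in V$, $|v|$ is the unique $k\in\mathbb{N}_0$ with $\mathsf{par}^k(v)=\mathsf{root}$. A path in $\mathcal{T}$ is a subgraph $\mathscr{P}=(V_{\mathscr{P}},E_{\mathscr{P}})$ of $\mathcal{T}$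 which is itself a directed tree, contains $\mathsf{root}$, and is such that every $v\in V_{\mathscr{P}}$ has exactly one child in $\mathscr{P}$. The weighted shift $S_{\boldsymbol\lambda}$ is given by $(S_{\boldsymbol\lambda}f)(v)=\lambda_v f(\mathsf{par}(v))$ for $v\in V^\circ$ and $(S_{\boldsymbol\lambda}f)(\mathsf{root})=0$, $f\in\ell^2(V)$; it is a bounded operator on $\ell^2(V)$ when $\sup_{v\in V}\sum_{u\in\mathsf{Chi}(v)}|\lambda_u|^2<\infty$. If $\mathsf{par}^k(v)=u$, set $\lambda_{u|v}=\prod_{n=0}^{k-1}\lambda_{\mathsf{par}^n(v)}$ (equal to $1$ if $k=0$). For a path $\mathscr{P}$, $$r_2^{\mathscr{P}}(S_{\boldsymbol\lambda})=\lim_{n\to\infty}\inf\big\{(\lambda_{\mathsf{root}|v})^{1/|v|}\colon v\in V_{\mathscr{P}},\ |v|\geq n\big\}.$$ For a Hilbert space $\mathcal{H}$ and a subalgebra $\mathscr{W}$ of the algebra $\mathbf{B}(\mathcal{H})$ of bounded operators, $\mathbf{Lat}\,\mathscr{W}$ is the set of closed subspaces of $\mathcal{H}$ invariant for all operators in $\mathscr{W}$. For a family $\mathcal{F}$ of closed subspaces, $\mathbf{Alg}\,\mathcal{F}=\{A\in\mathbf{B}(\mathcal{H})\colon A\mathcal{L}\subseteq\mathcal{L}\text{ for every }\mathcal{L}\in\mathcal{F}\}$. $\mathscr{W}$ is reflexive if $\mathbf{Alg}\,\mathbf{Lat}\,\mathscr{W}=\mathscr{W}$. An operator $A\in\mathbf{B}(\mathcal{H})$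 is reflexive if the smallest algebra containing $A$ and the identity $I$ and closed in the weak operator topology is reflexive. *)

theory Defs
  imports "HOL-Analysis.Analysis"
begin

section \<open>Directed trees\<close>

definition directed_tree :: "'a set \<Rightarrow> ('a \<times> 'a) set \<Rightarrow> bool" where
  "directed_tree V E \<longleftrightarrow>
     V \<noteq> {} \<and>
     E \<subseteq> {(u, v) \<in> V \<times> V. u \<noteq> v} \<and>
     (\<forall>u\<in>V. \<forall>v\<in>V. (u, v) \<in> (E \<union> E\<inverse>)\<^sup>*) \<and>
     acyclic E \<and>
     (\<forall>u u' v. (u, v) \<in> E \<longrightarrow> (u', v) \<in> E \<longrightarrow> u = u')"

definition children :: "('a \<times> 'a) set \<Rightarrow> 'a \<Rightarrow> 'a set" where
  "children E u = {v. (u, v) \<in> E}"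

definition is_root :: "'a set \<Rightarrow> ('a \<times> 'a) set \<Rightarrow> 'a \<Rightarrow> bool" where
  "is_root V E r \<longleftrightarrow> r \<in> V \<and> (\<nexists>u. (u, r) \<in> E)"

definition rooted :: "'a set \<Rightarrow> ('a \<times> 'a) set \<Rightarrow> bool" where
  "rooted V E \<longleftrightarrow> (\<exists>r. is_root V E r)"

definition tree_root :: "'a set \<Rightarrow> ('a \<times> 'a) set \<Rightarrow> 'a" where
  "tree_root V E = (THE r. is_root V E r)"

definition leafless :: "'a set \<Rightarrow> ('a \<times> 'a) set \<Rightarrow> bool" where
  "leafless V E \<longleftrightarrow> (\<forall>v\<in>V. children E v \<noteq> {})"

text \<open>The value at a root is unspecified.\<close>

definition par :: "('a \<times> 'a) set \<Rightarrow> 'a \<Rightarrow> 'a" where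
  "par E v = (THE u. (u, v) \<in> E)"

text \<open>
  The unique \<open>k\<close> for which the \<open>k\<close>-fold parent of \<open>v\<close> is \<open>u\<close>. Since the parent map is
  partial, this is phrased by \<open>(u, v) \<in> E ^^ k\<close> (relational power) rather than by
  \<open>(par E ^^ k) v = u\<close>, where the unspecified value of the total function \<open>par E\<close> at the root
  could interfere with uniqueness of \<open>k\<close>.
\<close>

definition generation :: "('a \<times> 'a) set \<Rightarrow> 'a \<Rightarrow> 'a \<Rightarrow> nat" where
  "generation E u v = (THE k. (u, v) \<in> E ^^ k)"

definition depth :: "'a set \<Rightarrow> ('a \<times> 'a) set \<Rightarrow> 'a \<Rightarrow> nat" where
  "depth V E v = generation E (tree_root V E) v"

definition tree_path ::
  "'a set \<Rightarrow> ('a \<times> 'a) set \<Rightarrow> 'a set \<Rightarrow> ('a \<times> 'a) set \<Rightarrow> bool" where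
  "tree_path V E VP EP \<longleftrightarrow>
     VP \<subseteq> V \<and> EP \<subseteq> E \<and> directed_tree VP EP \<and> tree_root V E \<in> VP \<and>
     (\<forall>v\<in>VP. \<exists>!u. u \<in> children EP v)"


section \<open>The Hilbert space of square-summable functions and its bounded operators\<close>

text \<open>
  Square-summable complex functions on \<open>V\<close>, represented by functions on the ambient type that
  vanish off \<open>V\<close>, so that distinct functions represent distinct vectors.
\<close>

definition ell2 :: "'a set \<Rightarrow> ('a \<Rightarrow> complex) set" where
  "ell2 V = {f. (\<forall>v. v \<notin> V \<longrightarrow> f v = 0) \<and> (\<lambda>v. (cmod (f v))\<^sup>2) summable_on V}"

definition ell2_inner :: "'a set \<Rightarrow> ('a \<Rightarrow> complex) \<Rightarrow> ('a \<Rightarrow> complex) \<Rightarrow> complex" where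
  "ell2_inner V f g = (\<Sum>\<^sub>\<infinity>v\<in>V. f v * cnj (g v))"

definition ell2_norm :: "'a set \<Rightarrow> ('a \<Rightarrow> complex) \<Rightarrow> real" where
  "ell2_norm V f = sqrt (\<Sum>\<^sub>\<infinity>v\<in>V. (cmod (f v))\<^sup>2)"

definition ell2_dist :: "'a set \<Rightarrow> ('a \<Rightarrow> complex) \<Rightarrow> ('a \<Rightarrow> complex) \<Rightarrow> real" where
  "ell2_dist V f g = ell2_norm V (\<lambda>v. f v - g v)"

lemma ell2_add: assumes "f \<in> ell2 V" "g \<in> ell2 V" shows "(\<lambda>v. f v + g v) \<in> ell2 V"
proof -
  have s: "(\<lambda>v. 2 * (cmod (f v))\<^sup>2 + 2 * (cmod (g v))\<^sup>2) summable_on V"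
    using assms by (intro summable_on_add summable_on_cmult_right) (auto simp: ell2_def)
  have "(cmod (f v + g v))\<^sup>2 \<le> 2 * (cmod (f v))\<^sup>2 + 2 * (cmod (g v))\<^sup>2" for v
  proof -
    have "(cmod (f v + g v))\<^sup>2 \<le> (cmod (f v) + cmod (g v))\<^sup>2"
      by (intro power_mono norm_triangle_ineq) simp
    also have "\<dots> \<le> 2 * (cmod (f v))\<^sup>2 + 2 * (cmod (g v))\<^sup>2"
      using sum_squares_bound[of "cmod (f v)" "cmod (g v)"] by (simp add: power2_sum)
    finally show ?thesis .
  qed
  then have "(\<lambda>v. (cmod (f v + g v))\<^sup>2) summable_on V"
    by (intro summable_on_comparison_test[OF s]) auto
  with assms show ?thesis by (auto simp: ell2_def)
qed

lemma ell2_minus: "f \<in> ell2 V \<Longrightarrow> (\<lambda>v. - f v) \<in> ell2 V"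
  by (auto simp: ell2_def)

lemma ell2_diff: "f \<in> ell2 V \<Longrightarrow> g \<in> ell2 V \<Longrightarrow> (\<lambda>v. f v - g v) \<in> ell2 V"
  using ell2_add[OF _ ell2_minus, of f V g] by simp

lemma L2_le_ell2_norm:
  assumes "f \<in> ell2 V" "finite F" "F \<subseteq> V"
  shows "L2_set (\<lambda>v. cmod (f v)) F \<le> ell2_norm V f"
  unfolding L2_set_def ell2_norm_def
  using assms by (intro real_sqrt_le_mono finite_sum_le_infsum) (auto simp: ell2_def)

lemma ell2_norm_triangle:
  assumes f: "f \<in> ell2 V" and g: "g \<in> ell2 V"
  shows "ell2_norm V (\<lambda>v. f v + g v) \<le> ell2_norm V f + ell2_norm V g"
proof -
  have nn: "0 \<le> ell2_norm V f + ell2_norm V g"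
    by (simp add: ell2_norm_def infsum_nonneg)
  have "(\<Sum>\<^sub>\<infinity>v\<in>V. (cmod (f v + g v))\<^sup>2) \<le> (ell2_norm V f + ell2_norm V g)\<^sup>2"
  proof (rule infsum_le_finite_sums)
    show "(\<lambda>v. (cmod (f v + g v))\<^sup>2) summable_on V" using ell2_add[OF f g] by (simp add: ell2_def)
  next
    fix F assume F: "finite F" "F \<subseteq> V"
    have "L2_set (\<lambda>v. cmod (f v + g v)) F \<le> L2_set (\<lambda>v. cmod (f v) + cmod (g v)) F"
      by (intro L2_set_mono norm_triangle_ineq) auto
    also have "\<dots> \<le> L2_set (\<lambda>v. cmod (f v)) F + L2_set (\<lambda>v. cmod (g v)) F"
      by (rule L2_set_triangle_ineq)
    also have "\<dots> \<le> ell2_norm V f + ell2_norm V g"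
      by (intro add_mono L2_le_ell2_norm f g F)
    finally have "sqrt (\<Sum>v\<in>F. (cmod (f v + g v))\<^sup>2) \<le> ell2_norm V f + ell2_norm V g"
      by (simp add: L2_set_def)
    then show "(\<Sum>v\<in>F. (cmod (f v + g v))\<^sup>2) \<le> (ell2_norm V f + ell2_norm V g)\<^sup>2"
      using nn by (simp add: sqrt_le_D)
  qed
  then have "sqrt (\<Sum>\<^sub>\<infinity>v\<in>V. (cmod (f v + g v))\<^sup>2) \<le> ell2_norm V f + ell2_norm V g"
    by (rule real_le_lsqrt[OF nn])
  then show ?thesis by (simp add: ell2_norm_def)
qed

lemma ell2_norm_eq_0:
  assumes "f \<in> ell2 V" shows "ell2_norm V f = 0 \<longleftrightarrow> f = (\<lambda>v. 0)"
proof
  assume "ell2_norm V f = 0"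
  then have z: "infsum (\<lambda>v. (cmod (f v))\<^sup>2) V = 0" by (simp add: ell2_norm_def)
  have "f v = 0" for v
  proof (cases "v \<in> V")
    case True
    have "(cmod (f v))\<^sup>2 = 0"
      using assms z True by (intro nonneg_infsum_le_0D[of "\<lambda>v. (cmod (f v))\<^sup>2" V]) (auto simp: ell2_def)
    then show ?thesis by simp
  qed (use assms in \<open>auto simp: ell2_def\<close>)
  then show "f = (\<lambda>v. 0)" by auto
qed (simp add: ell2_norm_def)

lemma Metric_space_ell2: "Metric_space (ell2 V) (ell2_dist V)"
proof
  fix f g :: "'a \<Rightarrow> complex"
  show "0 \<le> ell2_dist V f g" by (simp add: ell2_dist_def ell2_norm_def infsum_nonneg)
  show "ell2_dist V f g = ell2_dist V g f"
    by (simp add: ell2_dist_def ell2_norm_def norm_minus_commute)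
next
  fix f g :: "'a \<Rightarrow> complex" assume fg: "f \<in> ell2 V" "g \<in> ell2 V"
  show "ell2_dist V f g = 0 \<longleftrightarrow> f = g"
    using ell2_norm_eq_0[OF ell2_diff[OF fg]] by (auto simp: ell2_dist_def fun_eq_iff)
  fix h assume h: "h \<in> ell2 V"
  show "ell2_dist V f h \<le> ell2_dist V f g + ell2_dist V g h"
    using ell2_norm_triangle[OF ell2_diff[OF fg] ell2_diff[OF fg(2) h]]
    by (simp add: ell2_dist_def)
qed

definition ell2_topology :: "'a set \<Rightarrow> ('a \<Rightarrow> complex) topology" where
  "ell2_topology V = Metric_space.mtopology (ell2 V) (ell2_dist V)"

definition closed_subspace :: "'a set \<Rightarrow> ('a \<Rightarrow> complex) set \<Rightarrow> bool" where
  "closed_subspace V L \<longleftrightarrow>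
     L \<subseteq> ell2 V \<and>
     (\<lambda>v. 0) \<in> L \<and>
     (\<forall>f\<in>L. \<forall>g\<in>L. (\<lambda>v. f v + g v) \<in> L) \<and>
     (\<forall>c. \<forall>f\<in>L. (\<lambda>v. c * f v) \<in> L) \<and>
     closedin (ell2_topology V) L"

type_synonym 'a ell2_op = "('a \<Rightarrow> complex) \<Rightarrow> ('a \<Rightarrow> complex)"

text \<open>
  Operators are extensional functions on \<^term>\<open>ell2 V\<close> (fixed to \<^term>\<open>undefined\<close> elsewhere), so
  that equality of operators is equality as maps on \<^term>\<open>ell2 V\<close>.
\<close>

definition bounded_ops :: "'a set \<Rightarrow> 'a ell2_op set" where
  "bounded_ops V = {A \<in> ell2 V \<rightarrow>\<^sub>E ell2 V.
     (\<forall>f\<in>ell2 V. \<forall>g\<in>ell2 V. A (\<lambda>v. f v + g v) = (\<lambda>v. A f v + A g v)) \<and>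
     (\<forall>c. \<forall>f\<in>ell2 V. A (\<lambda>v. c * f v) = (\<lambda>v. c * A f v)) \<and>
     (\<exists>C. \<forall>f\<in>ell2 V. ell2_norm V (A f) \<le> C * ell2_norm V f)}"

definition op_zero :: "'a set \<Rightarrow> 'a ell2_op" where
  "op_zero V = (\<lambda>f\<in>ell2 V. \<lambda>v. 0)"

definition op_id :: "'a set \<Rightarrow> 'a ell2_op" where
  "op_id V = (\<lambda>f\<in>ell2 V. f)"

definition op_add :: "'a set \<Rightarrow> 'a ell2_op \<Rightarrow> 'a ell2_op \<Rightarrow> 'a ell2_op" where
  "op_add V A B = (\<lambda>f\<in>ell2 V. \<lambda>v. A f v + B f v)"

definition op_scale :: "'a set \<Rightarrow> complex \<Rightarrow> 'a ell2_op \<Rightarrow> 'a ell2_op" where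
  "op_scale V c A = (\<lambda>f\<in>ell2 V. \<lambda>v. c * A f v)"

definition subalgebra :: "'a set \<Rightarrow> 'a ell2_op set \<Rightarrow> bool" where
  "subalgebra V W \<longleftrightarrow>
     W \<subseteq> bounded_ops V \<and>
     op_zero V \<in> W \<and>
     (\<forall>A\<in>W. \<forall>B\<in>W. op_add V A B \<in> W) \<and>
     (\<forall>c. \<forall>A\<in>W. op_scale V c A \<in> W) \<and>
     (\<forall>A\<in>W. \<forall>B\<in>W. compose (ell2 V) A B \<in> W)"

text \<open>
  The weak operator topology: the initial topology on the bounded operators for the maps
  \<open>A \<mapsto> \<langle>A f, g\<rangle>\<close>, indexed by pairs \<open>(f, g)\<close>.
\<close>

definition wot :: "'a set \<Rightarrow> 'a ell2_op topology" where
  "wot V = pullback_topology (bounded_ops V)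
     (\<lambda>A. \<lambda>(f, g)\<in>ell2 V \<times> ell2 V. ell2_inner V (A f) g)
     (product_topology (\<lambda>_. euclidean) (ell2 V \<times> ell2 V))"

lemma topspace_wot: "topspace (wot V) = bounded_ops V"
  by (auto simp: wot_def topspace_pullback_topology)


section \<open>Reflexivity\<close>

definition Lat :: "'a set \<Rightarrow> 'a ell2_op set \<Rightarrow> ('a \<Rightarrow> complex) set set" where
  "Lat V W = {L. closed_subspace V L \<and> (\<forall>A\<in>W. A ` L \<subseteq> L)}"

definition Alg :: "'a set \<Rightarrow> ('a \<Rightarrow> complex) set set \<Rightarrow> 'a ell2_op set" where
  "Alg V F = {A \<in> bounded_ops V. \<forall>L\<in>F. A ` L \<subseteq> L}"

definition reflexive_algebra :: "'a set \<Rightarrow> 'a ell2_op set \<Rightarrow> bool" where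
  "reflexive_algebra V W \<longleftrightarrow> Alg V (Lat V W) = W"

definition generated_wot_algebra :: "'a set \<Rightarrow> 'a ell2_op \<Rightarrow> 'a ell2_op set" where
  "generated_wot_algebra V A =
     \<Inter>{W. subalgebra V W \<and> A \<in> W \<and> op_id V \<in> W \<and> closedin (wot V) W}"

definition reflexive_op :: "'a set \<Rightarrow> 'a ell2_op \<Rightarrow> bool" where
  "reflexive_op V A \<longleftrightarrow> reflexive_algebra V (generated_wot_algebra V A)"


section \<open>Weighted shifts\<close>

definition weighted_shift ::
  "'a set \<Rightarrow> ('a \<times> 'a) set \<Rightarrow> ('a \<Rightarrow> real) \<Rightarrow> 'a ell2_op" where
  "weighted_shift V E lam = (\<lambda>f\<in>ell2 V. \<lambda>v.
     if v \<in> V - {tree_root V E} then complex_of_real (lam v) * f (par E v) else 0)"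

definition weight_between :: "('a \<times> 'a) set \<Rightarrow> ('a \<Rightarrow> real) \<Rightarrow> 'a \<Rightarrow> 'a \<Rightarrow> real" where
  "weight_between E lam u v = (\<Prod>n<generation E u v. lam ((par E ^^ n) v))"

text \<open>
  The infima increase with \<open>n\<close>; when the weighted shift is bounded they are bounded above by
  its norm, so the limit exists in the reals. The vertex of depth \<open>0\<close>, whose root exponent
  \<open>1 / 0\<close> is meaningless, is only present for \<open>n = 0\<close> and does not affect the limit.
\<close>

definition r2_path ::
  "'a set \<Rightarrow> ('a \<times> 'a) set \<Rightarrow> ('a \<Rightarrow> real) \<Rightarrow> 'a set \<Rightarrow> real" where
  "r2_path V E lam VP =
     lim (\<lambda>n. Inf {weight_between E lam (tree_root V E) v powr (1 / real (depth V E v)) |v.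
                   v \<in> VP \<and> n \<le> depth V E v})"

end

theory Submission
  imports Defs
begin

text \<open>
  Along a branch \<open>v\<^sub>0, v\<^sub>1, \<dots>\<close> from the root, \<open>\<Sum>\<^sub>n z\<^sup>n f(v\<^sub>n) / \<lambda>(root|v\<^sub>n)\<close> is the inner product of \<open>f\<close>
  with an eigenvector of the adjoint of the shift \<open>S\<close>; since \<open>r\<^sub>2 > 0\<close> on the branch, the
  eigenvector is square-summable for small \<open>z\<close>. An operator \<open>A\<close> in \<open>Alg Lat S\<close> leaves the
  annihilators of the eigenvectors invariant, so in terms of these power series it is
  multiplication by the series of \<open>A e\<close>, where \<open>e\<close> is the indicator of the root. As \<open>A e\<close> lies in
  the closed invariant subspace of functions whose normalised coefficients depend only on the
  depth, the multiplier is the same on all branches, that is, \<open>A = \<Sum>\<^sub>k a\<^sub>k S\<^sup>k\<close> formally. The Cesaro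
  means of this series are polynomials in \<open>S\<close>, bounded in norm by \<open>A\<close>, and converge to \<open>A\<close>
  weakly.
\<close>

section \<open>Square-summable functions\<close>

lemma ell2_summable: "f \<in> ell2 V \<Longrightarrow> (\<lambda>v. (cmod (f v))\<^sup>2) summable_on V"
  by (simp add: ell2_def)

lemma ell2_norm_nonneg: "0 \<le> ell2_norm V f"
  by (simp add: ell2_norm_def infsum_nonneg)

lemma ell2_norm_sq: "(ell2_norm V f)\<^sup>2 = (\<Sum>\<^sub>\<infinity>v\<in>V. (cmod (f v))\<^sup>2)"
  by (simp add: ell2_norm_def infsum_nonneg)

lemma ell2_zero: "(\<lambda>v. 0) \<in> ell2 V"
  by (simp add: ell2_def)

lemma ell2_scale: "f \<in> ell2 V \<Longrightarrow> (\<lambda>v. c * f v) \<in> ell2 V"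
  by (auto simp: ell2_def norm_mult power_mult_distrib intro: summable_on_cmult_right)

lemma ell2_norm_scale: "ell2_norm V (\<lambda>v. c * f v) = cmod c * ell2_norm V f"
  by (simp add: ell2_norm_def norm_mult power_mult_distrib infsum_cmult_right' real_sqrt_mult)

lemma ell2_dominated:
  assumes "f \<in> ell2 V" "\<And>v. cmod (g v) \<le> cmod (f v)"
  shows "g \<in> ell2 V"
proof -
  have "g v = 0" if "v \<notin> V" for v
    using assms that by (metis (mono_tags, lifting) ell2_def mem_Collect_eq norm_le_zero_iff norm_zero)
  moreover have "(\<lambda>v. (cmod (g v))\<^sup>2) summable_on V"
    by (rule summable_on_comparison_test[OF ell2_summable[OF assms(1)]])
      (auto intro: power_mono assms(2))
  ultimately show ?thesis by (simp add: ell2_def)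
qed

lemma ell2_finite_support:
  assumes "finite F" "F \<subseteq> V" "\<And>v. v \<notin> F \<Longrightarrow> f v = 0"
  shows "f \<in> ell2 V"
proof -
  have "((\<lambda>v. (cmod (f v))\<^sup>2) has_sum (\<Sum>v\<in>F. (cmod (f v))\<^sup>2)) V"
    by (rule has_sum_finite_neutralI[OF assms(1,2)]) (auto simp: assms(3))
  then show ?thesis using assms(2,3) by (auto simp: ell2_def summable_on_def)
qed

lemma ell2_norm_le_finite_sums:
  assumes f: "f \<in> ell2 V" and C: "0 \<le> C"
    and le: "\<And>F. finite F \<Longrightarrow> F \<subseteq> V \<Longrightarrow> (\<Sum>v\<in>F. (cmod (f v))\<^sup>2) \<le> C\<^sup>2"
  shows "ell2_norm V f \<le> C"
proof -
  have "(\<Sum>\<^sub>\<infinity>v\<in>V. (cmod (f v))\<^sup>2) \<le> C\<^sup>2"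
    by (rule infsum_le_finite_sums[OF ell2_summable[OF f] le])
  then show ?thesis unfolding ell2_norm_def by (rule real_le_lsqrt[OF C])
qed

lemma sum_le_ell2_norm_sq:
  assumes "f \<in> ell2 V" "finite F" "F \<subseteq> V"
  shows "(\<Sum>v\<in>F. (cmod (f v))\<^sup>2) \<le> (ell2_norm V f)\<^sup>2"
  unfolding ell2_norm_sq using assms by (intro finite_sum_le_infsum ell2_summable) auto

lemma cmod_le_ell2_norm:
  assumes "f \<in> ell2 V" shows "cmod (f v) \<le> ell2_norm V f"
proof (cases "v \<in> V")
  case True
  then show ?thesis using L2_le_ell2_norm[OF assms, of "{v}"] by simp
next
  case False
  then show ?thesis using assms ell2_norm_nonneg by (simp add: ell2_def)
qed

section \<open>Inner products and weak convergence\<close>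

lemma ell2_inner_abs_summable:
  assumes "f \<in> ell2 V" "g \<in> ell2 V"
  shows "(\<lambda>v. cmod (f v * cnj (g v))) summable_on V"
proof (rule summable_on_comparison_test)
  show "(\<lambda>v. (cmod (f v))\<^sup>2 + (cmod (g v))\<^sup>2) summable_on V"
    by (intro summable_on_add ell2_summable assms)
  show "cmod (f v * cnj (g v)) \<le> (cmod (f v))\<^sup>2 + (cmod (g v))\<^sup>2" for v
    using sum_squares_bound[of "cmod (f v)" "cmod (g v)"]
      mult_nonneg_nonneg[OF norm_ge_zero[of "f v"] norm_ge_zero[of "g v"]]
    by (simp add: norm_mult del: mult_nonneg_nonneg zero_le_mult_iff)
qed simp

lemma ell2_inner_summable:
  "f \<in> ell2 V \<Longrightarrow> g \<in> ell2 V \<Longrightarrow> (\<lambda>v. f v * cnj (g v)) summable_on V"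
  by (rule abs_summable_summable[OF ell2_inner_abs_summable])

lemma ell2_inner_le:
  assumes "f \<in> ell2 V" "g \<in> ell2 V"
  shows "cmod (ell2_inner V f g) \<le> ell2_norm V f * ell2_norm V g"
proof -
  have "cmod (ell2_inner V f g) \<le> (\<Sum>\<^sub>\<infinity>v\<in>V. norm (f v * cnj (g v)))"
    unfolding ell2_inner_def by (rule norm_infsum_bound[OF ell2_inner_abs_summable[OF assms]])
  also have "\<dots> \<le> ell2_norm V f * ell2_norm V g"
  proof (rule infsum_le_finite_sums[OF ell2_inner_abs_summable[OF assms]])
    fix F assume F: "finite F" "F \<subseteq> V"
    have "(\<Sum>v\<in>F. norm (f v * cnj (g v))) \<le> L2_set (\<lambda>v. cmod (f v)) F * L2_set (\<lambda>v. cmod (g v)) F"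
      using L2_set_mult_ineq[of "\<lambda>v. cmod (f v)" "\<lambda>v. cmod (g v)" F] by (simp add: norm_mult)
    also have "\<dots> \<le> ell2_norm V f * ell2_norm V g"
      by (intro mult_mono L2_le_ell2_norm assms F ell2_norm_nonneg) simp
    finally show "(\<Sum>v\<in>F. norm (f v * cnj (g v))) \<le> ell2_norm V f * ell2_norm V g" .
  qed
  finally show ?thesis .
qed

lemma ell2_inner_add_left:
  assumes "f \<in> ell2 V" "h \<in> ell2 V" "g \<in> ell2 V"
  shows "ell2_inner V (\<lambda>v. f v + h v) g = ell2_inner V f g + ell2_inner V h g"
  unfolding ell2_inner_def
  by (simp add: ring_distribs infsum_add ell2_inner_summable assms)

lemma ell2_inner_scale_left:
  "ell2_inner V (\<lambda>v. c * f v) g = c * ell2_inner V f g"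
  unfolding ell2_inner_def by (simp add: mult.assoc infsum_cmult_right')

lemma ell2_inner_diff_left:
  assumes "f \<in> ell2 V" "h \<in> ell2 V" "g \<in> ell2 V"
  shows "ell2_inner V (\<lambda>v. f v - h v) g = ell2_inner V f g - ell2_inner V h g"
  using ell2_inner_add_left[OF assms(1) ell2_scale[OF assms(2), of "-1"] assms(3)]
    ell2_inner_scale_left[of V "-1" h g] by simp

lemma ell2_inner_add_right:
  assumes "f \<in> ell2 V" "h \<in> ell2 V" "g \<in> ell2 V"
  shows "ell2_inner V f (\<lambda>v. g v + h v) = ell2_inner V f g + ell2_inner V f h"
  unfolding ell2_inner_def
  by (simp add: ring_distribs infsum_add ell2_inner_summable assms)

lemma ell2_inner_finite_support:
  assumes "finite F" "F \<subseteq> V" "\<And>v. v \<notin> F \<Longrightarrow> g v = 0"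
  shows "ell2_inner V f g = (\<Sum>v\<in>F. f v * cnj (g v))"
  unfolding ell2_inner_def
  by (rule infsumI, rule has_sum_finite_neutralI[OF assms(1,2)]) (auto simp: assms(3))

lemma ell2_norm_tail_less:
  assumes g: "g \<in> ell2 V" and e: "0 < e"
  obtains F where "finite F" "F \<subseteq> V" "ell2_norm V (\<lambda>v. if v \<in> F then 0 else g v) < e"
proof -
  let ?s = "\<lambda>v. (cmod (g v))\<^sup>2"
  \<comment> \<open>The approximation yields only a non-strict bound; halving \<open>e\<close> makes
    the final inequality strict.\<close>
  obtain F where F: "finite F" "F \<subseteq> V" "dist (sum ?s F) (infsum ?s V) \<le> (e/2)\<^sup>2"
    using infsum_finite_approximation[OF ell2_summable[OF g], of "(e/2)\<^sup>2"] e by auto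
  let ?h = "\<lambda>v. if v \<in> F then 0 else g v"
  have "(\<Sum>\<^sub>\<infinity>v\<in>V. (cmod (?h v))\<^sup>2) = infsum ?s (V - F)"
    by (rule infsum_cong_neutral) auto
  also have "\<dots> = infsum ?s V - sum ?s F"
    using F g by (simp add: infsum_Diff ell2_summable)
  also have "\<dots> \<le> (e/2)\<^sup>2" using F(3) by (simp add: dist_real_def)
  finally have "ell2_norm V ?h \<le> e/2"
    unfolding ell2_norm_def using e by (intro real_le_lsqrt) auto
  then have "ell2_norm V ?h < e" using e by simp
  with F(1,2) show thesis by (rule that)
qed

text \<open>Split \<open>g\<close> into a finitely supported part, handled by pointwise convergence,
  and a part of small norm, handled by Cauchy-Schwarz and the uniform bound
  \<open>K\<close>.\<close>

lemma ell2_weak_convergence: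
  assumes h: "\<And>n. h n \<in> ell2 V" and f: "f \<in> ell2 V" and g: "g \<in> ell2 V"
    and bound: "\<And>n. ell2_norm V (h n) \<le> K"
    and pointwise: "\<And>v. v \<in> V \<Longrightarrow> (\<lambda>n. h n v) \<longlonglongrightarrow> f v"
  shows "(\<lambda>n. ell2_inner V (h n) g) \<longlonglongrightarrow> ell2_inner V f g"
proof (rule LIMSEQ_I)
  fix e :: real assume e: "0 < e"
  define d where "d n = (\<lambda>v. h n v - f v)" for n
  have d: "d n \<in> ell2 V" for n unfolding d_def by (intro ell2_diff h f)
  \<comment> \<open>\<open>M\<close> bounds the norms of all \<open>d n\<close>; the summand 1 makes
    it positive, so that \<open>e / (2 * M)\<close> can serve as a tolerance.\<close>
  define M where "M = K + ell2_norm V f + 1"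
  have "0 \<le> K" using order_trans[OF ell2_norm_nonneg bound[of 0]] .
  then have M: "0 < M" using ell2_norm_nonneg[of V f] by (simp add: M_def)
  have dM: "ell2_norm V (d n) \<le> M" for n
    using ell2_norm_triangle[OF h[of n] ell2_scale[OF f, of "-1"]] ell2_norm_scale[of V "-1" f]
      bound[of n] by (simp add: d_def M_def)
  obtain F where F: "finite F" "F \<subseteq> V"
    and tail: "ell2_norm V (\<lambda>v. if v \<in> F then 0 else g v) < e / (2 * M)"
    using ell2_norm_tail_less[OF g, of "e / (2 * M)"] e M by auto
  let ?g1 = "\<lambda>v. if v \<in> F then g v else 0" and ?g2 = "\<lambda>v. if v \<in> F then 0 else g v"
  have g1: "?g1 \<in> ell2 V" and g2: "?g2 \<in> ell2 V"
    by (auto intro: ell2_dominated[OF g])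
  have "(\<lambda>n. \<Sum>v\<in>F. d n v * cnj (g v)) \<longlonglongrightarrow> (\<Sum>v\<in>F. 0 * cnj (g v))"
    using F(2) by (intro tendsto_intros) (auto simp: d_def intro!: LIM_zero pointwise)
  then obtain N where N: "\<And>n. n \<ge> N \<Longrightarrow> cmod (\<Sum>v\<in>F. d n v * cnj (g v)) < e / 2"
    using LIMSEQ_D[of _ 0 "e/2"] e by fastforce
  have "cmod (ell2_inner V (h n) g - ell2_inner V f g) < e" if "n \<ge> N" for n
  proof -
    have "ell2_inner V (h n) g - ell2_inner V f g = ell2_inner V (d n) g"
      unfolding d_def by (rule ell2_inner_diff_left[OF h f g, symmetric])
    also have "\<dots> = ell2_inner V (d n) (\<lambda>v. ?g1 v + ?g2 v)"
      by (rule arg_cong[of _ _ "ell2_inner V (d n)"]) auto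
    also have "\<dots> = ell2_inner V (d n) ?g1 + ell2_inner V (d n) ?g2"
      by (rule ell2_inner_add_right[OF d g2 g1])
    also have "ell2_inner V (d n) ?g1 = (\<Sum>v\<in>F. d n v * cnj (g v))"
      by (subst ell2_inner_finite_support[OF F]) auto
    finally have eq: "ell2_inner V (h n) g - ell2_inner V f g =
      (\<Sum>v\<in>F. d n v * cnj (g v)) + ell2_inner V (d n) ?g2" .
    have "cmod (ell2_inner V (d n) ?g2) \<le> ell2_norm V (d n) * ell2_norm V ?g2"
      by (rule ell2_inner_le[OF d g2])
    also have "\<dots> \<le> M * (e / (2 * M))"
      using dM tail M by (intro mult_mono) (auto simp: ell2_norm_nonneg)
    also have "\<dots> = e / 2" using M by simp
    finally have "cmod (ell2_inner V (d n) ?g2) \<le> e / 2" .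
    then show ?thesis unfolding eq using N[OF that] norm_triangle_ineq
      by (smt (verit, best) field_sum_of_halves)
  qed
  then show "\<exists>N. \<forall>n\<ge>N. cmod (ell2_inner V (h n) g - ell2_inner V f g) < e" by blast
qed


section \<open>Annihilators and the weak operator topology\<close>

definition annihilator :: "'a set \<Rightarrow> ('a \<Rightarrow> complex) set \<Rightarrow> ('a \<Rightarrow> complex) set" where
  "annihilator V G = {f \<in> ell2 V. \<forall>g\<in>G. ell2_inner V f g = 0}"

lemma closed_subspace_annihilator:
  assumes G: "G \<subseteq> ell2 V"
  shows "closed_subspace V (annihilator V G)"
proof -
  interpret Metric_space "ell2 V" "ell2_dist V" by (rule Metric_space_ell2)
  have "closedin mtopology (annihilator V G)"
    unfolding closedin_metric
  proof (intro conjI allI impI)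
    fix f assume "f \<in> ell2 V - annihilator V G"
    then obtain g where f: "f \<in> ell2 V" and g: "g \<in> G" "ell2_inner V f g \<noteq> 0"
      by (auto simp: annihilator_def)
    have gV: "g \<in> ell2 V" using g G by auto
    \<comment> \<open>By Cauchy-Schwarz, moving \<open>f\<close> by less than \<open>r\<close>
      changes its inner product with \<open>g\<close> by less than the modulus of that product,
      which therefore cannot become 0. The \<open>+ 1\<close> keeps the denominator
      positive.\<close>
    define r where "r = cmod (ell2_inner V f g) / (ell2_norm V g + 1)"
    have pos: "0 < ell2_norm V g + 1" using ell2_norm_nonneg[of V g] by linarith
    have "0 < r" using g pos by (simp add: r_def)
    moreover have "h \<notin> mball f r" if h: "h \<in> annihilator V G" for h
    proof
      assume hf: "h \<in> mball f r"
      have hV: "h \<in> ell2 V" using h by (simp add: annihilator_def)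
      have "ell2_inner V f g = ell2_inner V (\<lambda>v. f v - h v) g"
        using h g by (simp add: ell2_inner_diff_left[OF f hV gV] annihilator_def)
      then have "cmod (ell2_inner V f g) \<le> ell2_dist V f h * ell2_norm V g"
        using ell2_inner_le[OF ell2_diff[OF f hV] gV] by (simp add: ell2_dist_def)
      also have "\<dots> \<le> r * ell2_norm V g"
        using hf by (intro mult_right_mono ell2_norm_nonneg) auto
      also have "\<dots> < r * (ell2_norm V g + 1)" using \<open>0 < r\<close> by simp
      also have "\<dots> = cmod (ell2_inner V f g)" using pos by (simp add: r_def)
      finally show False by simp
    qed
    ultimately show "\<exists>r>0. disjnt (annihilator V G) (mball f r)"
      unfolding disjnt_def by blast
  qed (auto simp: annihilator_def)
  then show ?thesis
    using G by (auto simp: closed_subspace_def annihilator_def ell2_zero ell2_add ell2_scale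
        ell2_inner_add_left ell2_inner_scale_left ell2_topology_def subset_iff)
      (simp add: ell2_inner_def)
qed

section \<open>Bounded operators and algebras of them\<close>

lemma bounded_opsI:
  assumes "\<And>f. f \<notin> ell2 V \<Longrightarrow> A f = undefined"
    and "\<And>f. f \<in> ell2 V \<Longrightarrow> A f \<in> ell2 V"
    and "\<And>f g. f \<in> ell2 V \<Longrightarrow> g \<in> ell2 V \<Longrightarrow> A (\<lambda>v. f v + g v) = (\<lambda>v. A f v + A g v)"
    and "\<And>c f. f \<in> ell2 V \<Longrightarrow> A (\<lambda>v. c * f v) = (\<lambda>v. c * A f v)"
    and "\<And>f. f \<in> ell2 V \<Longrightarrow> ell2_norm V (A f) \<le> C * ell2_norm V f"
  shows "A \<in> bounded_ops V"
  using assms unfolding bounded_ops_def PiE_def extensional_def by blast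

lemma bounded_ops_maps: "A \<in> bounded_ops V \<Longrightarrow> f \<in> ell2 V \<Longrightarrow> A f \<in> ell2 V"
  by (auto simp: bounded_ops_def)

lemma bounded_ops_add:
  "A \<in> bounded_ops V \<Longrightarrow> f \<in> ell2 V \<Longrightarrow> g \<in> ell2 V \<Longrightarrow> A (\<lambda>v. f v + g v) = (\<lambda>v. A f v + A g v)"
  by (simp add: bounded_ops_def)

lemma bounded_ops_scale:
  "A \<in> bounded_ops V \<Longrightarrow> f \<in> ell2 V \<Longrightarrow> A (\<lambda>v. c * f v) = (\<lambda>v. c * A f v)"
  by (simp add: bounded_ops_def)

lemma bounded_ops_bound:
  assumes "A \<in> bounded_ops V"
  obtains C where "0 \<le> C" "\<And>f. f \<in> ell2 V \<Longrightarrow> ell2_norm V (A f) \<le> C * ell2_norm V f"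
proof -
  obtain C where C: "\<And>f. f \<in> ell2 V \<Longrightarrow> ell2_norm V (A f) \<le> C * ell2_norm V f"
    using assms unfolding bounded_ops_def by blast
  show thesis
  proof (rule that[of "\<bar>C\<bar>"])
    fix f assume "f \<in> ell2 V"
    have "C * ell2_norm V f \<le> \<bar>C\<bar> * ell2_norm V f"
      by (intro mult_right_mono ell2_norm_nonneg) simp
    then show "ell2_norm V (A f) \<le> \<bar>C\<bar> * ell2_norm V f" using C[OF \<open>f \<in> ell2 V\<close>] by linarith
  qed simp
qed

lemma op_zero_bounded: "op_zero V \<in> bounded_ops V"
  by (auto simp: op_zero_def bounded_ops_def ell2_zero ell2_add ell2_scale ell2_norm_def
      intro!: exI[of _ 0])

lemma op_id_bounded: "op_id V \<in> bounded_ops V"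
  by (auto simp: op_id_def bounded_ops_def ell2_add ell2_scale intro!: exI[of _ 1])

lemma op_add_bounded:
  assumes A: "A \<in> bounded_ops V" and B: "B \<in> bounded_ops V"
  shows "op_add V A B \<in> bounded_ops V"
proof -
  obtain C where C: "0 \<le> C" "\<And>f. f \<in> ell2 V \<Longrightarrow> ell2_norm V (A f) \<le> C * ell2_norm V f"
    using bounded_ops_bound[OF A] by metis
  obtain D where D: "0 \<le> D" "\<And>f. f \<in> ell2 V \<Longrightarrow> ell2_norm V (B f) \<le> D * ell2_norm V f"
    using bounded_ops_bound[OF B] by metis
  have "ell2_norm V (\<lambda>v. A f v + B f v) \<le> (C + D) * ell2_norm V f" if "f \<in> ell2 V" for f
    using ell2_norm_triangle[OF bounded_ops_maps[OF A that] bounded_ops_maps[OF B that]]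
      C(2)[OF that] D(2)[OF that] by (simp add: ring_distribs)
  then show ?thesis
    by (intro bounded_opsI[where C = "C + D"])
      (simp_all add: op_add_def ell2_add ell2_scale bounded_ops_maps[OF A] bounded_ops_maps[OF B]
        bounded_ops_add[OF A] bounded_ops_add[OF B] bounded_ops_scale[OF A]
        bounded_ops_scale[OF B] ring_distribs add_ac)
qed

lemma op_scale_bounded:
  assumes A: "A \<in> bounded_ops V"
  shows "op_scale V c A \<in> bounded_ops V"
proof -
  obtain C where C: "0 \<le> C" "\<And>f. f \<in> ell2 V \<Longrightarrow> ell2_norm V (A f) \<le> C * ell2_norm V f"
    using bounded_ops_bound[OF A] by metis
  have "ell2_norm V (\<lambda>v. c * A f v) \<le> (cmod c * C) * ell2_norm V f" if "f \<in> ell2 V" for f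
    using C(2)[OF that] by (simp add: ell2_norm_scale mult.assoc mult_left_mono)
  then show ?thesis
    by (intro bounded_opsI[where C = "cmod c * C"])
      (simp_all add: op_scale_def ell2_add ell2_scale bounded_ops_maps[OF A]
        bounded_ops_add[OF A] bounded_ops_scale[OF A] ring_distribs mult_ac)
qed

lemma compose_bounded:
  assumes A: "A \<in> bounded_ops V" and B: "B \<in> bounded_ops V"
  shows "compose (ell2 V) A B \<in> bounded_ops V"
proof -
  obtain C where C: "0 \<le> C" "\<And>f. f \<in> ell2 V \<Longrightarrow> ell2_norm V (A f) \<le> C * ell2_norm V f"
    using bounded_ops_bound[OF A] by metis
  obtain D where D: "0 \<le> D" "\<And>f. f \<in> ell2 V \<Longrightarrow> ell2_norm V (B f) \<le> D * ell2_norm V f"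
    using bounded_ops_bound[OF B] by metis
  have "ell2_norm V (A (B f)) \<le> (C * D) * ell2_norm V f" if "f \<in> ell2 V" for f
    using C(2)[OF bounded_ops_maps[OF B that]] mult_left_mono[OF D(2)[OF that] C(1)]
    by (simp add: mult.assoc)
  then show ?thesis
    by (intro bounded_opsI[where C = "C * D"])
      (simp_all add: compose_def ell2_add ell2_scale bounded_ops_maps[OF A] bounded_ops_maps[OF B]
        bounded_ops_add[OF A] bounded_ops_add[OF B] bounded_ops_scale[OF A] bounded_ops_scale[OF B])
qed

lemma subalgebra_bounded_ops: "subalgebra V (bounded_ops V)"
  by (simp add: subalgebra_def op_zero_bounded op_add_bounded op_scale_bounded compose_bounded)

lemma subalgebra_Alg:
  assumes L: "closed_subspace V L"
  shows "subalgebra V (Alg V {L})"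
proof -
  have sub: "f \<in> ell2 V" if "f \<in> L" for f using L that by (auto simp: closed_subspace_def)
  show ?thesis
    using L op_zero_bounded[of V] op_add_bounded[of _ V] op_scale_bounded[of _ V]
      compose_bounded[of _ V]
    unfolding subalgebra_def Alg_def closed_subspace_def
    by (auto simp: sub image_subset_iff op_zero_def op_add_def op_scale_def compose_def)
qed

lemma op_id_in_Alg: "closed_subspace V L \<Longrightarrow> op_id V \<in> Alg V {L}"
  using op_id_bounded[of V] by (auto simp: Alg_def op_id_def closed_subspace_def)

section \<open>The weak operator topology and the generated algebra\<close>

lemma continuous_map_wot_inner:
  assumes "f \<in> ell2 V" "g \<in> ell2 V"
  shows "continuous_map (wot V) euclidean (\<lambda>A. ell2_inner V (A f) g)"
proof -
  have "continuous_map (product_topology (\<lambda>_. euclidean) (ell2 V \<times> ell2 V))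
      euclidean (\<lambda>x. x (f, g) :: complex)"
    using assms by (intro continuous_map_product_coordinates) auto
  from continuous_map_pullback[OF this]
  have "continuous_map (wot V) euclidean
      ((\<lambda>x. x (f, g)) \<circ> (\<lambda>A. \<lambda>(f, g)\<in>ell2 V \<times> ell2 V. ell2_inner V (A f) g))"
    unfolding wot_def .
  then show ?thesis using assms by (simp add: o_def)
qed

text \<open>Each condition \<open>ell2_inner V (A f) g = 0\<close> is the preimage of a point under
  a weakly continuous functional, and invariance of an annihilator is an intersection of such
  conditions.\<close>

lemma closedin_wot_Alg_annihilator:
  assumes G: "G \<subseteq> ell2 V"
  shows "closedin (wot V) (Alg V {annihilator V G})"
proof -
  let ?Z = "\<lambda>(f, g). {A \<in> topspace (wot V). ell2_inner V (A f) g \<in> {0}}"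
  \<comment> \<open>Inserting the whole space keeps the intersection inside
    \<open>bounded_ops V\<close> when \<open>G\<close> is empty and there is no pair to
    test.\<close>
  have eq: "Alg V {annihilator V G} =
      \<Inter> (insert (topspace (wot V)) (?Z ` (annihilator V G \<times> G)))"
    using bounded_ops_maps[of _ V]
    by (auto simp: Alg_def annihilator_def topspace_wot image_subset_iff)
  have Z: "closedin (wot V) (?Z p)" if "p \<in> annihilator V G \<times> G" for p
  proof -
    have "fst p \<in> ell2 V" "snd p \<in> ell2 V" using that G by (auto simp: annihilator_def)
    from closedin_continuous_map_preimage[OF continuous_map_wot_inner[OF this], of "{0}"]
    show ?thesis by (simp add: case_prod_beta)
  qed
  show ?thesis
    unfolding eq by (rule closedin_Inter) (use Z in auto)
qed

text \<open>Convergence of all inner products is coordinatewise convergence in the product topology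
  that is pulled back, so a sequence in a closed set cannot converge to a point of the open
  complement.\<close>

lemma closedin_wot_sequence:
  assumes W: "closedin (wot V) W" and B: "\<And>n. B n \<in> W" and A: "A \<in> bounded_ops V"
    and lim: "\<And>f g. f \<in> ell2 V \<Longrightarrow> g \<in> ell2 V \<Longrightarrow>
      (\<lambda>n. ell2_inner V (B n f) g) \<longlonglongrightarrow> ell2_inner V (A f) g"
  shows "A \<in> W"
proof (rule ccontr)
  assume "A \<notin> W"
  let ?\<Phi> = "\<lambda>A. \<lambda>(f, g)\<in>ell2 V \<times> ell2 V. ell2_inner V (A f) g"
  have WB: "W \<subseteq> bounded_ops V" using closedin_subset[OF W] by (simp add: topspace_wot)
  have "openin (wot V) (bounded_ops V - W)"
    using W by (simp add: closedin_def topspace_wot)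
  then obtain U where U: "openin (product_topology (\<lambda>_. euclidean) (ell2 V \<times> ell2 V)) U"
      "bounded_ops V - W = ?\<Phi> -` U \<inter> bounded_ops V"
    unfolding wot_def openin_pullback_topology by blast
  have "limitin (product_topology (\<lambda>_. euclidean) (ell2 V \<times> ell2 V)) (\<lambda>n. ?\<Phi> (B n)) (?\<Phi> A) sequentially"
    unfolding limitin_componentwise by (auto simp: lim)
  then have "\<forall>\<^sub>F n in sequentially. ?\<Phi> (B n) \<in> U"
    using U A \<open>A \<notin> W\<close> unfolding limitin_def by blast
  then obtain n where "?\<Phi> (B n) \<in> U" by (auto simp: eventually_sequentially)
  then show False using U(2) B[of n] WB by blast
qed

lemma generated_wot_algebra_least:
  "subalgebra V W \<Longrightarrow> A \<in> W \<Longrightarrow> op_id V \<in> W \<Longrightarrow> closedin (wot V) W \<Longrightarrow> generated_wot_algebra V A \<subseteq> W"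
  unfolding generated_wot_algebra_def by blast

lemma generated_wot_algebra_bounded:
  assumes "A \<in> bounded_ops V"
  shows "generated_wot_algebra V A \<subseteq> bounded_ops V"
  using closedin_topspace[of "wot V"] assms
  by (intro generated_wot_algebra_least subalgebra_bounded_ops op_id_bounded)
    (simp_all add: topspace_wot)

text \<open>For annihilators, weak closedness of \<^term>\<open>Alg V {L}\<close> is immediate, so that no orthogonal
  projections are needed.\<close>

lemma Alg_Lat_generated_annihilator:
  assumes A: "A \<in> Alg V (Lat V (generated_wot_algebra V S))" and S: "S \<in> bounded_ops V"
    and G: "G \<subseteq> ell2 V"
    and inv: "\<And>f. f \<in> annihilator V G \<Longrightarrow> S f \<in> annihilator V G"
    and f: "f \<in> annihilator V G"
  shows "A f \<in> annihilator V G"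
proof -
  note L = closed_subspace_annihilator[OF G]
  have "generated_wot_algebra V S \<subseteq> Alg V {annihilator V G}"
    using S inv
    by (intro generated_wot_algebra_least subalgebra_Alg L op_id_in_Alg
        closedin_wot_Alg_annihilator G) (auto simp: Alg_def)
  then have "annihilator V G \<in> Lat V (generated_wot_algebra V S)"
    using L by (auto simp: Lat_def Alg_def)
  then show ?thesis using A f by (auto simp: Alg_def)
qed

text \<open>The restriction to \<open>ell2 V\<close> is there because operators are extensional,
  whereas \<open>S ^^ 0\<close> is the identity on all functions.\<close>

lemma subalgebra_polynomial:
  assumes W: "subalgebra V W" and S: "S \<in> W" and I: "op_id V \<in> W"
  shows "(\<lambda>f\<in>ell2 V. \<lambda>v. \<Sum>k<n. c k * (S ^^ k) f v) \<in> W"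
proof -
  have SB: "S \<in> bounded_ops V" using W S by (auto simp: subalgebra_def)
  have maps: "(S ^^ k) f \<in> ell2 V" if "f \<in> ell2 V" for k f
    using that by (induction k) (auto intro: bounded_ops_maps[OF SB])
  have pow: "(\<lambda>f\<in>ell2 V. (S ^^ k) f) \<in> W" for k
  proof (induction k)
    case 0
    then show ?case using I by (simp add: op_id_def restrict_def)
  next
    case (Suc k)
    have "compose (ell2 V) S (\<lambda>f\<in>ell2 V. (S ^^ k) f) \<in> W"
      using W S Suc unfolding subalgebra_def by blast
    moreover have "compose (ell2 V) S (\<lambda>f\<in>ell2 V. (S ^^ k) f) = (\<lambda>f\<in>ell2 V. (S ^^ Suc k) f)"
      by (auto simp: compose_def fun_eq_iff)
    ultimately show ?case by (simp only:)
  qed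
  show ?thesis
  proof (induction n)
    case 0
    then show ?case using W by (simp add: subalgebra_def op_zero_def restrict_def)
  next
    case (Suc n)
    have "op_add V (\<lambda>f\<in>ell2 V. \<lambda>v. \<Sum>k<n. c k * (S ^^ k) f v)
        (op_scale V (c n) (\<lambda>f\<in>ell2 V. (S ^^ n) f)) \<in> W"
      using W Suc pow unfolding subalgebra_def by blast
    moreover have "op_add V (\<lambda>f\<in>ell2 V. \<lambda>v. \<Sum>k<n. c k * (S ^^ k) f v)
        (op_scale V (c n) (\<lambda>f\<in>ell2 V. (S ^^ n) f)) = (\<lambda>f\<in>ell2 V. \<lambda>v. \<Sum>k<Suc n. c k * (S ^^ k) f v)"
      by (auto simp: op_add_def op_scale_def fun_eq_iff)
    ultimately show ?case by (simp only:)
  qed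
qed


section \<open>Rooted leafless trees and their branches\<close>

locale weighted_tree =
  fixes V :: "'a set" and E :: "('a \<times> 'a) set" and lam :: "'a \<Rightarrow> real"
  assumes directed_tree: "directed_tree V E"
    and rooted: "rooted V E"
    and leafless: "leafless V E"
    and lam_pos: "v \<in> V - {tree_root V E} \<Longrightarrow> lam v > 0"
    and shift_bounded: "weighted_shift V E lam \<in> bounded_ops V"
    and r2_pos: "tree_path V E VP EP \<Longrightarrow> r2_path V E lam VP > 0"
begin

abbreviation rt :: 'a where "rt \<equiv> tree_root V E"
abbreviation dep :: "'a \<Rightarrow> nat" where "dep \<equiv> depth V E"
abbreviation S :: "'a ell2_op" where "S \<equiv> weighted_shift V E lam"
abbreviation wt :: "'a \<Rightarrow> real" where "wt \<equiv> weight_between E lam rt"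

lemma edge_vertices: "(u, v) \<in> E \<Longrightarrow> u \<in> V \<and> v \<in> V"
  using directed_tree by (auto simp: directed_tree_def)

lemma edge_unique: "(u, v) \<in> E \<Longrightarrow> (u', v) \<in> E \<Longrightarrow> u = u'"
  using directed_tree unfolding directed_tree_def by blast

text \<open>Follow an undirected walk from \<open>r\<close>: a step against an edge merely undoes
  the last edge of the directed path, since parents are unique, and it cannot start at
  \<open>r\<close>, which has no parent.\<close>

lemma is_root_reaches:
  assumes r: "is_root V E r" and v: "v \<in> V"
  shows "(r, v) \<in> E\<^sup>*"
proof -
  have "(r, v) \<in> (E \<union> E\<inverse>)\<^sup>*"
    using directed_tree r v by (auto simp: directed_tree_def is_root_def)
  then show ?thesis
  proof (induction rule: rtrancl_induct)
    case (step y z)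
    show ?case
    proof (cases "(y, z) \<in> E")
      case True
      then show ?thesis using step.IH by auto
    next
      case False
      then have zy: "(z, y) \<in> E" using step.hyps by auto
      from step.IH show ?thesis
      proof (cases rule: rtranclE)
        case base
        then show ?thesis using zy r by (auto simp: is_root_def)
      next
        case (step w)
        then show ?thesis using edge_unique[OF zy] by auto
      qed
    qed
  qed auto
qed

lemma is_root_root: "is_root V E rt"
proof -
  obtain r where r: "is_root V E r" using rooted by (auto simp: rooted_def)
  have "r' = r" if r': "is_root V E r'" for r'
    using is_root_reaches[OF r, of r'] r' by (auto simp: is_root_def elim: rtranclE)
  then show ?thesis unfolding tree_root_def using theI[of "is_root V E" r] r by blast
qed

lemma root_in: "rt \<in> V" and no_edge_root: "(u, rt) \<notin> E"
  using is_root_root by (auto simp: is_root_def)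

lemma par_eq: "(u, v) \<in> E \<Longrightarrow> par E v = u"
  unfolding par_def using edge_unique by blast

text \<open>Unique parents make the last edges of both paths coincide, and no edge enters the root,
  so the paths shrink together. This justifies the definite description in
  \<open>generation\<close>.\<close>

lemma relpow_root_unique: "(rt, v) \<in> E ^^ k \<Longrightarrow> (rt, v) \<in> E ^^ m \<Longrightarrow> k = m"
proof (induction k arbitrary: m v)
  case 0
  then show ?case using no_edge_root by (cases m) auto
next
  case (Suc k)
  then obtain u where u: "(rt, u) \<in> E ^^ k" "(u, v) \<in> E" by auto
  then obtain m' where m: "m = Suc m'" using Suc.prems(2) no_edge_root by (cases m) auto
  then obtain u' where u': "(rt, u') \<in> E ^^ m'" "(u', v) \<in> E" using Suc.prems(2) by auto
  have "u' = u" by (rule edge_unique[OF u'(2) u(2)])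
  with Suc.IH[OF u(1)] u'(1) m show ?case by simp
qed

lemma generation_eq: "(rt, v) \<in> E ^^ k \<Longrightarrow> generation E rt v = k"
  unfolding generation_def using relpow_root_unique by blast

lemma relpow_depth:
  assumes "v \<in> V" shows "(rt, v) \<in> E ^^ dep v"
  using is_root_reaches[OF is_root_root assms] generation_eq
  by (metis depth_def rtrancl_imp_relpow)

lemma depth_root [simp]: "dep rt = 0"
  using generation_eq[of rt 0] by (simp add: depth_def)

lemma depth_child: "(u, v) \<in> E \<Longrightarrow> dep v = Suc (dep u)"
  using relpow_depth[of u] edge_vertices[of u v] generation_eq[of v "Suc (dep u)"]
  by (auto simp: depth_def)

lemma wt_root [simp]: "wt rt = 1"
  using depth_root by (simp add: weight_between_def depth_def)

lemma wt_child:
  assumes "(u, v) \<in> E" shows "wt v = lam v * wt u"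
proof -
  have "wt v = (\<Prod>n<Suc (dep u). lam ((par E ^^ n) v))"
    using depth_child[OF assms] by (simp only: weight_between_def depth_def)
  also have "\<dots> = lam v * (\<Prod>n<dep u. lam ((par E ^^ Suc n) v))"
    by (simp only: prod.lessThan_Suc_shift funpow_0)
  also have "\<dots> = lam v * wt u"
    by (simp only: funpow_Suc_right o_apply par_eq[OF assms] weight_between_def depth_def)
  finally show ?thesis .
qed

lemma tree_induct [consumes 1, case_names root child]:
  assumes "v \<in> V" "P rt" "\<And>u v. (u, v) \<in> E \<Longrightarrow> P u \<Longrightarrow> P v"
  shows "P v"
  using is_root_reaches[OF is_root_root assms(1)]
  by (induction rule: rtrancl_induct) (use assms in auto)

lemma wt_pos: "v \<in> V \<Longrightarrow> wt v > 0"
proof (induction rule: tree_induct)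
  case (child u v)
  then have "0 < lam v" using lam_pos[of v] edge_vertices[of u v] no_edge_root[of u] by auto
  then show ?case using child by (simp add: wt_child)
qed simp

text \<open>A path of the tree, parametrised by depth, so that sums over its vertices become
  series.\<close>

definition branch :: "(nat \<Rightarrow> 'a) \<Rightarrow> bool" where
  "branch p \<longleftrightarrow> p 0 = rt \<and> (\<forall>n. (p n, p (Suc n)) \<in> E)"

lemma branch_in: "branch p \<Longrightarrow> p n \<in> V"
  using edge_vertices by (auto simp: branch_def)

lemma branch_depth: "branch p \<Longrightarrow> dep (p n) = n"
proof (induction n)
  case 0
  then show ?case by (simp add: branch_def)
next
  case (Suc n)
  then show ?case using depth_child[of "p n" "p (Suc n)"] by (simp add: branch_def)
qed

lemma branch_inj: "branch p \<Longrightarrow> inj p"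
  by (metis branch_depth injI)

text \<open>Leaflessness lets the path from the root to \<open>v\<close> be continued by chosen
  children. Identities at a vertex thereby reduce to identities along one branch.\<close>

lemma branch_through:
  assumes v: "v \<in> V"
  obtains p where "branch p" "p (dep v) = v"
proof -
  obtain f where f: "f 0 = rt" "f (dep v) = v" "\<And>i. i < dep v \<Longrightarrow> (f i, f (Suc i)) \<in> E"
    using relpow_depth[OF v] unfolding relpow_fun_conv by blast
  define c where "c u = (SOME w. (u, w) \<in> E)" for u
  have c: "(u, c u) \<in> E" if "u \<in> V" for u
    using leafless that unfolding c_def leafless_def children_def by (auto intro: someI_ex)
  have cV: "(c ^^ k) v \<in> V" for k
    by (induction k) (use v c edge_vertices in auto)
  define p where "p n = (if n \<le> dep v then f n else (c ^^ (n - dep v)) v)" for n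
  have "(p n, p (Suc n)) \<in> E" for n
  proof (cases "n < dep v")
    case True
    then show ?thesis using f by (simp add: p_def)
  next
    case False
    then have "p n = (c ^^ (n - dep v)) v" using f by (auto simp: p_def)
    moreover have "p (Suc n) = c ((c ^^ (n - dep v)) v)"
      using False by (simp add: p_def Suc_diff_le)
    ultimately show ?thesis using c[OF cV] by simp
  qed
  then have "branch p" using f by (simp add: branch_def p_def)
  moreover have "p (dep v) = v" using f by (simp add: p_def)
  ultimately show thesis by (rule that)
qed

text \<open>Makes the hypothesis \<open>r2_pos\<close> available along branches.\<close>

lemma branch_tree_path:
  assumes p: "branch p"
  shows "tree_path V E (range p) (range (\<lambda>n. (p n, p (Suc n))))"
proof -
  let ?E = "range (\<lambda>n. (p n, p (Suc n)))"
  note inj = branch_inj[OF p]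
  have sub: "?E \<subseteq> E" using p by (auto simp: branch_def)
  have from0: "(p 0, p n) \<in> (?E \<union> ?E\<inverse>)\<^sup>*" for n
  proof (induction n)
    case (Suc n)
    have "(p n, p (Suc n)) \<in> ?E \<union> ?E\<inverse>" by auto
    with Suc show ?case by (rule rtrancl_into_rtrancl)
  qed simp
  have "sym ((?E \<union> ?E\<inverse>)\<^sup>*)" by (intro sym_rtrancl sym_Un_converse)
  then have conn: "(p m, p n) \<in> (?E \<union> ?E\<inverse>)\<^sup>*" for m n
    using from0[of m] from0[of n] by (meson rtrancl_trans symD)
  have "directed_tree (range p) ?E"
    unfolding directed_tree_def
  proof (intro conjI)
    show "?E \<subseteq> {(u, v) \<in> range p \<times> range p. u \<noteq> v}"
      using inj by (auto simp: inj_eq)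
    show "\<forall>u\<in>range p. \<forall>v\<in>range p. (u, v) \<in> (?E \<union> ?E\<inverse>)\<^sup>*"
    proof (intro ballI)
      fix u v assume "u \<in> range p" "v \<in> range p"
      then obtain m n where "u = p m" "v = p n" by (elim rangeE)
      then show "(u, v) \<in> (?E \<union> ?E\<inverse>)\<^sup>*" using conn[of m n] by (simp only:)
    qed
    show "acyclic ?E"
      using directed_tree sub acyclic_subset unfolding directed_tree_def by metis
    show "\<forall>u u' v. (u, v) \<in> ?E \<longrightarrow> (u', v) \<in> ?E \<longrightarrow> u = u'"
    proof (intro allI impI)
      fix u u' v assume "(u, v) \<in> ?E" "(u', v) \<in> ?E"
      then show "u = u'" by (intro edge_unique[of u v u'] subsetD[OF sub])
    qed
  qed simp
  moreover have "\<forall>v\<in>range p. \<exists>!u. u \<in> children ?E v"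
    using inj by (auto simp: children_def inj_eq)
  moreover have "tree_root V E \<in> range p"
    using p by (auto simp: branch_def intro: range_eqI[of _ _ 0])
  moreover have "range p \<subseteq> V" using branch_in[OF p] by (rule image_subsetI)
  ultimately show ?thesis using sub unfolding tree_path_def by (intro conjI)
qed


section \<open>Growth of the weights along a branch\<close>

definition delta :: "'a \<Rightarrow> 'a \<Rightarrow> complex" where
  "delta u = (\<lambda>v. if v = u then 1 else 0)"

lemma delta_in: "u \<in> V \<Longrightarrow> delta u \<in> ell2 V"
  by (rule ell2_finite_support[of "{u}"]) (auto simp: delta_def)

lemma ell2_norm_delta: "u \<in> V \<Longrightarrow> ell2_norm V (delta u) = 1"
proof -
  assume u: "u \<in> V"
  have "(\<Sum>\<^sub>\<infinity>v\<in>V. (cmod (delta u v))\<^sup>2) = (\<Sum>\<^sub>\<infinity>v\<in>{u}. (cmod (delta u v))\<^sup>2)"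
    by (rule infsum_cong_neutral) (use u in \<open>auto simp: delta_def\<close>)
  then show ?thesis by (simp add: ell2_norm_def delta_def)
qed

lemma shift_child:
  assumes "f \<in> ell2 V" "(u, v) \<in> E"
  shows "S f v = complex_of_real (lam v) * f u"
  using assms edge_vertices no_edge_root par_eq by (auto simp: weighted_shift_def)

lemma shift_root: "f \<in> ell2 V \<Longrightarrow> S f rt = 0"
  by (simp add: weighted_shift_def)

text \<open>A weight \<open>lam v\<close> is a coordinate of \<open>S (delta u)\<close> for the
  parent \<open>u\<close> of \<open>v\<close>, hence at most the operator bound. The result serves
  to bound the infima in \<open>r2_path\<close> from above.\<close>

lemma wt_le_power:
  obtains C where "1 \<le> C" "\<And>v. v \<in> V \<Longrightarrow> wt v \<le> C ^ dep v"
proof -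
  obtain C where C: "0 \<le> C" "\<And>f. f \<in> ell2 V \<Longrightarrow> ell2_norm V (S f) \<le> C * ell2_norm V f"
    using bounded_ops_bound[OF shift_bounded] by metis
  have lam: "lam v \<le> max C 1" if "(u, v) \<in> E" for u v
  proof -
    have u: "u \<in> V" using edge_vertices[OF that] by simp
    have "\<bar>lam v\<bar> = cmod (S (delta u) v)"
      unfolding shift_child[OF delta_in[OF u] that] by (simp add: delta_def)
    also have "\<dots> \<le> ell2_norm V (S (delta u))"
      by (intro cmod_le_ell2_norm bounded_ops_maps[OF shift_bounded] delta_in u)
    also have "\<dots> \<le> C" using C(2)[OF delta_in[OF u]] by (simp add: ell2_norm_delta u)
    finally show ?thesis by simp
  qed
  have "wt v \<le> max C 1 ^ dep v" if "v \<in> V" for v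
    using that
  proof (induction rule: tree_induct)
    case (child u v)
    have "0 < wt u" using wt_pos edge_vertices[OF child(1)] by simp
    then have "lam v * wt u \<le> max C 1 * max C 1 ^ dep u"
      using lam[OF child(1)] child(2) by (intro mult_mono) auto
    then show ?case by (simp add: wt_child[OF child(1)] depth_child[OF child(1)])
  qed simp
  then show thesis by (intro that[of "max C 1"]) auto
qed

text \<open>\<open>lim\<close> carries information only once convergence is known: the infima
  increase and are bounded above, so they converge, and half of their positive limit eventually
  bounds the roots of the weights from below.\<close>

lemma branch_wt_ge_power:
  assumes p: "branch p"
  obtains c where "0 < c" "\<forall>\<^sub>F n in sequentially. c ^ n \<le> wt (p n)"
proof -
  define X where "X n = {wt v powr (1 / real (dep v)) |v. v \<in> range p \<and> n \<le> dep v}" for n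
  have r2: "lim (\<lambda>n. Inf (X n)) > 0"
    using r2_pos[OF branch_tree_path[OF p]] unfolding r2_path_def X_def .
  have X: "X n = (\<lambda>m. wt (p m) powr (1 / real m)) ` {n..}" for n
  proof -
    have "X n = {wt (p m) powr (1 / real (dep (p m))) |m. n \<le> dep (p m)}"
      unfolding X_def by blast
    then show ?thesis by (auto simp: branch_depth[OF p])
  qed
  have pos: "0 < wt (p m)" for m by (intro wt_pos branch_in p)
  have bdd: "bdd_below (X n)" for n unfolding X by (intro bdd_belowI[of _ 0]) auto
  obtain C where C: "1 \<le> C" "\<And>v. v \<in> V \<Longrightarrow> wt v \<le> C ^ dep v" using wt_le_power by metis
  have upper: "wt (p m) powr (1 / real m) \<le> C" if "m > 0" for m
  proof -
    have "wt (p m) powr (1 / real m) \<le> (C powr real m) powr (1 / real m)"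
      using C branch_in[OF p, of m] pos[of m]
      by (intro powr_mono2) (auto simp: powr_realpow branch_depth[OF p] less_imp_le dest: C(2))
    also have "\<dots> = C" using that C by (simp add: powr_powr)
    finally show ?thesis .
  qed
  have "incseq (\<lambda>n. Inf (X n))"
    unfolding incseq_def
    by (intro allI impI cInf_superset_mono bdd) (auto simp: X)
  moreover have "Inf (X n) \<le> C" for n
  proof -
    have "wt (p (Suc n)) powr (1 / real (Suc n)) \<in> X n" unfolding X by (rule imageI) simp
    from order_trans[OF cInf_lower[OF this bdd] upper] show ?thesis by simp
  qed
  ultimately obtain L where L: "(\<lambda>n. Inf (X n)) \<longlonglongrightarrow> L"
    using incseq_convergent by metis
  then have "L > 0" using r2 by (simp add: limI)
  then have "\<forall>\<^sub>F n in sequentially. L / 2 < Inf (X n)"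
    using order_tendstoD(1)[OF L, of "L / 2"] by simp
  then obtain N where N: "\<And>n. n \<ge> N \<Longrightarrow> L / 2 < Inf (X n)"
    by (auto simp: eventually_sequentially)
  \<comment> \<open>\<open>Suc N\<close> excludes depth 0, where the exponent
    \<open>1 / real n\<close> has the default value 0.\<close>
  have "(L / 2) ^ n \<le> wt (p n)" if n: "n \<ge> Suc N" for n
  proof -
    have "L / 2 \<le> wt (p n) powr (1 / real n)"
      using N[of n] n cInf_lower[OF _ bdd, of "wt (p n) powr (1 / real n)" n] by (auto simp: X)
    then have "(L / 2) ^ n \<le> (wt (p n) powr (1 / real n)) ^ n"
      using \<open>L > 0\<close> by (intro power_mono) auto
    also have "\<dots> = wt (p n)"
      using n pos[of n] by (simp add: powr_powr flip: powr_realpow)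
    finally show ?thesis .
  qed
  then have "\<forall>\<^sub>F n in sequentially. (L / 2) ^ n \<le> wt (p n)"
    unfolding eventually_sequentially by blast
  with \<open>L > 0\<close> show thesis by (intro that[of "L / 2"]) auto
qed


section \<open>Eigenvectors of the adjoint along a branch\<close>

text \<open>The coefficients of \<^term>\<open>f\<close> in the basis that turns \<^term>\<open>S\<close> into an unweighted shift
  along each branch.\<close>

definition coef :: "('a \<Rightarrow> complex) \<Rightarrow> 'a \<Rightarrow> complex" where
  "coef f v = f v / complex_of_real (wt v)"

lemma coef_mult_wt: "v \<in> V \<Longrightarrow> coef f v * complex_of_real (wt v) = f v"
  using wt_pos[of v] by (simp add: coef_def)

lemma coef_shift:
  assumes p: "branch p" and f: "f \<in> ell2 V"
  shows "coef (S f) (p 0) = 0" "coef (S f) (p (Suc n)) = coef f (p n)"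
proof -
  show "coef (S f) (p 0) = 0"
    using p f by (simp add: branch_def coef_def shift_root)
  have e: "(p n, p (Suc n)) \<in> E" using p by (simp add: branch_def)
  have "lam (p (Suc n)) \<noteq> 0" using wt_child[OF e] wt_pos[OF branch_in[OF p, of "Suc n"]] by auto
  then show "coef (S f) (p (Suc n)) = coef f (p n)"
    by (simp add: coef_def shift_child[OF f e] wt_child[OF e])
qed

lemma shift_power_in: "f \<in> ell2 V \<Longrightarrow> (S ^^ k) f \<in> ell2 V"
  by (induction k) (auto intro: bounded_ops_maps[OF shift_bounded])

lemma coef_shift_power:
  assumes p: "branch p" and f: "f \<in> ell2 V"
  shows "coef ((S ^^ k) f) (p n) = (if k \<le> n then coef f (p (n - k)) else 0)"
proof (induction k arbitrary: n)
  case (Suc k)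
  then show ?case
    using coef_shift[OF p shift_power_in[OF f, of k]] by (cases n) auto
qed simp

lemma shift_power_eq_0:
  assumes "f \<in> ell2 V" "v \<in> V" "dep v < k"
  shows "(S ^^ k) f v = 0"
proof -
  obtain p where p: "branch p" "p (dep v) = v" by (rule branch_through[OF assms(2)])
  have "coef ((S ^^ k) f) v = 0"
    using coef_shift_power[OF p(1) assms(1), of k "dep v"] p(2) assms(3) by simp
  then show ?thesis using coef_mult_wt[OF assms(2), of "(S ^^ k) f"] by simp
qed

text \<open>The reproducing kernel at \<open>z\<close> for the power series along \<open>p\<close>;
  the conjugate is there because the inner product is conjugate-linear in its second
  argument.\<close>

definition kernel :: "(nat \<Rightarrow> 'a) \<Rightarrow> complex \<Rightarrow> 'a \<Rightarrow> complex" where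
  "kernel p z v = (if v \<in> range p then cnj (z ^ dep v) / complex_of_real (wt v) else 0)"

text \<open>The lower bound on the weights dominates the coordinates along \<open>p\<close> by the
  geometric sequence \<open>(cmod z / c) ^ n\<close> for large \<open>n\<close>.\<close>

lemma kernel_in:
  assumes p: "branch p" and ev: "\<forall>\<^sub>F n in sequentially. c ^ n \<le> wt (p n)" and z: "cmod z < c"
  shows "kernel p z \<in> ell2 V"
proof -
  have c: "0 < c" using z norm_ge_zero[of z] by linarith
  have nk: "cmod (kernel p z (p n)) = cmod z ^ n / wt (p n)" for n
    using wt_pos[OF branch_in[OF p, of n]]
    by (simp add: kernel_def branch_depth[OF p] norm_divide norm_power)
  have "summable (\<lambda>n. (cmod (kernel p z (p n)))\<^sup>2)"
  proof (rule summable_comparison_test_ev)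
    show "\<forall>\<^sub>F n in sequentially. norm ((cmod (kernel p z (p n)))\<^sup>2) \<le> ((cmod z / c)\<^sup>2) ^ n"
      using ev
    proof (rule eventually_mono)
      fix n assume "c ^ n \<le> wt (p n)"
      then have "cmod z ^ n / wt (p n) \<le> cmod z ^ n / c ^ n"
        using c by (intro divide_left_mono mult_pos_pos wt_pos branch_in p) auto
      also have "\<dots> = (cmod z / c) ^ n" by (simp add: power_divide)
      finally have "cmod (kernel p z (p n)) \<le> (cmod z / c) ^ n" by (simp add: nk)
      then have "(cmod (kernel p z (p n)))\<^sup>2 \<le> ((cmod z / c) ^ n)\<^sup>2" by (intro power_mono) auto
      also have "\<dots> = ((cmod z / c)\<^sup>2) ^ n" by (simp flip: power_mult add: mult.commute)
      finally show "norm ((cmod (kernel p z (p n)))\<^sup>2) \<le> ((cmod z / c)\<^sup>2) ^ n" by simp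
    qed
    have "(cmod z / c)\<^sup>2 < 1" using z c by (simp add: power_less_one_iff)
    then show "summable (\<lambda>n. ((cmod z / c)\<^sup>2) ^ n)" by (intro summable_geometric) auto
  qed
  then have "(\<lambda>v. (cmod (kernel p z v))\<^sup>2) summable_on range p"
    by (simp add: summable_on_reindex[OF branch_inj[OF p]] o_def summable_on_UNIV_nonneg_real_iff)
  also have "?this \<longleftrightarrow> (\<lambda>v. (cmod (kernel p z v))\<^sup>2) summable_on V"
    by (rule summable_on_cong_neutral) (use branch_in[OF p] in \<open>auto simp: kernel_def\<close>)
  finally show ?thesis
    using branch_in[OF p] by (auto simp: ell2_def kernel_def)
qed

lemma sums_inner_kernel:
  assumes p: "branch p" and f: "f \<in> ell2 V" and k: "kernel p z \<in> ell2 V"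
  shows "(\<lambda>n. coef f (p n) * z ^ n) sums ell2_inner V f (kernel p z)"
proof -
  have "((\<lambda>v. f v * cnj (kernel p z v)) has_sum ell2_inner V f (kernel p z)) V"
    unfolding ell2_inner_def using ell2_inner_summable[OF f k] by simp
  also have "?this \<longleftrightarrow> ((\<lambda>v. f v * cnj (kernel p z v)) has_sum ell2_inner V f (kernel p z)) (range p)"
    by (rule has_sum_cong_neutral) (use branch_in[OF p] in \<open>auto simp: kernel_def\<close>)
  also have "\<dots> \<longleftrightarrow> ((\<lambda>n. coef f (p n) * z ^ n) has_sum ell2_inner V f (kernel p z)) UNIV"
    by (simp add: has_sum_reindex[OF branch_inj[OF p]] o_def kernel_def branch_depth[OF p] coef_def)
  finally show ?thesis by (rule has_sum_imp_sums)
qed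

text \<open>\<open>S\<close> moves the coefficients along \<open>p\<close> by one place, that is,
  multiplies the power series by \<open>z\<close>. Hence the annihilator of the kernel is invariant
  under \<open>S\<close>.\<close>

lemma inner_shift_kernel:
  assumes p: "branch p" and f: "f \<in> ell2 V" and k: "kernel p z \<in> ell2 V"
  shows "ell2_inner V (S f) (kernel p z) = z * ell2_inner V f (kernel p z)"
proof -
  have "(\<lambda>n. coef (S f) (p n) * z ^ n) sums (z * ell2_inner V f (kernel p z))"
  proof (rule sums_Suc_imp)
    show "(\<lambda>n. coef (S f) (p (Suc n)) * z ^ Suc n) sums (z * ell2_inner V f (kernel p z))"
      using sums_mult[OF sums_inner_kernel[OF p f k], of z]
      by (simp add: coef_shift[OF p f] mult_ac)
  qed (simp add: coef_shift[OF p f])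
  moreover have "(\<lambda>n. coef (S f) (p n) * z ^ n) sums ell2_inner V (S f) (kernel p z)"
    by (intro sums_inner_kernel p k bounded_ops_maps[OF shift_bounded f])
  ultimately show ?thesis by (rule sums_unique2[symmetric])
qed

lemma inner_delta_kernel:
  assumes p: "branch p"
  shows "ell2_inner V (delta rt) (kernel p z) = 1"
proof -
  have "ell2_inner V (delta rt) (kernel p z) = (\<Sum>\<^sub>\<infinity>v\<in>{rt}. delta rt v * cnj (kernel p z v))"
    unfolding ell2_inner_def
    by (rule infsum_cong_neutral) (use root_in in \<open>auto simp: delta_def\<close>)
  moreover have "rt \<in> range p" using p by (auto simp: branch_def intro: range_eqI[of _ _ 0])
  ultimately show ?thesis by (simp add: delta_def kernel_def)
qed


section \<open>Operators leaving the invariant subspaces of the shift invariant\<close>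

context
  fixes A :: "'a ell2_op"
  assumes A: "A \<in> Alg V (Lat V (generated_wot_algebra V S))"
begin

lemma A_bounded: "A \<in> bounded_ops V"
  using A by (simp add: Alg_def)

lemma A_annihilator:
  assumes "G \<subseteq> ell2 V" "\<And>f. f \<in> annihilator V G \<Longrightarrow> S f \<in> annihilator V G" "f \<in> annihilator V G"
  shows "A f \<in> annihilator V G"
  by (rule Alg_Lat_generated_annihilator[OF A shift_bounded assms])

text \<open>The kernel is an eigenvector of the adjoint of \<^term>\<open>A\<close>, and its eigenvalue is found by
  testing on the root.\<close>

lemma inner_A_kernel:
  assumes p: "branch p" and f: "f \<in> ell2 V" and k: "kernel p z \<in> ell2 V"
  shows "ell2_inner V (A f) (kernel p z) =
    ell2_inner V (A (delta rt)) (kernel p z) * ell2_inner V f (kernel p z)"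
proof -
  let ?k = "kernel p z"
  \<comment> \<open>The kernel has inner product 1 with \<open>delta rt\<close>, so this
    \<open>c\<close> makes \<open>h\<close> orthogonal to the kernel.\<close>
  define c where "c = - ell2_inner V f ?k"
  define h where "h = (\<lambda>v. f v + c * delta rt v)"
  note d = delta_in[OF root_in]
  have h: "h \<in> ell2 V" unfolding h_def by (intro ell2_add f ell2_scale d)
  have inner: "ell2_inner V (\<lambda>v. g v + c * g' v) ?k = ell2_inner V g ?k + c * ell2_inner V g' ?k"
    if "g \<in> ell2 V" "g' \<in> ell2 V" for g g'
    using ell2_inner_add_left[OF that(1) ell2_scale[OF that(2)] k] by (simp add: ell2_inner_scale_left)
  have "h \<in> annihilator V {?k}"
    using h inner[OF f d] by (simp add: annihilator_def h_def inner_delta_kernel[OF p] c_def)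
  then have "A h \<in> annihilator V {?k}"
    by (rule A_annihilator[rotated 2])
      (auto simp: k annihilator_def inner_shift_kernel[OF p _ k] bounded_ops_maps[OF shift_bounded])
  moreover have "A h = (\<lambda>v. A f v + c * A (delta rt) v)"
    unfolding h_def
    by (simp add: bounded_ops_add[OF A_bounded f ell2_scale[OF d]] bounded_ops_scale[OF A_bounded d])
  ultimately show ?thesis
    using inner[OF bounded_ops_maps[OF A_bounded f] bounded_ops_maps[OF A_bounded d]]
    by (simp add: annihilator_def c_def mult.commute)
qed

text \<open>By \<open>inner_A_kernel\<close>, the power series of \<open>A f\<close> is the product
  of those of \<open>A (delta rt)\<close> and \<open>f\<close> near 0; comparing coefficients gives
  the Cauchy product.\<close>

lemma coef_A_convolution:
  assumes p: "branch p" and f: "f \<in> ell2 V"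
  shows "coef (A f) (p n) = (\<Sum>k\<le>n. coef (A (delta rt)) (p k) * coef f (p (n - k)))"
proof -
  obtain c where c: "0 < c" and ev: "\<forall>\<^sub>F n in sequentially. c ^ n \<le> wt (p n)"
    by (rule branch_wt_ge_power[OF p])
  define F where "F g = Abs_fps (\<lambda>n. coef g (p n))" for g
  have k: "kernel p z \<in> ell2 V" if "cmod z < c" for z
    by (rule kernel_in[OF p ev that])
  have sums: "(\<lambda>n. coef g (p n) * z ^ n) sums ell2_inner V g (kernel p z)"
    if "cmod z < c" "g \<in> ell2 V" for g z
    by (rule sums_inner_kernel[OF p that(2) k[OF that(1)]])
  have eval: "eval_fps (F g) z = ell2_inner V g (kernel p z)" if "cmod z < c" "g \<in> ell2 V" for g z
    using sums_unique[OF sums[OF that]] by (simp add: eval_fps_def F_def)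
  \<comment> \<open>Convergence at every real \<open>r\<close> with \<open>0 < r < c\<close> already
    forces the radius to be at least \<open>c\<close>.\<close>
  have radius: "fps_conv_radius (F g) \<ge> ereal c" if "g \<in> ell2 V" for g
    unfolding fps_conv_radius_def
  proof (rule conv_radius_geI_ex')
    fix r assume "0 < r" "ereal r < ereal c"
    then show "summable (\<lambda>n. fps_nth (F g) n * of_real r ^ n)"
      using sums_summable[OF sums[of "of_real r", OF _ that]] by (simp add: F_def)
  qed
  have Af: "A f \<in> ell2 V" and Ad: "A (delta rt) \<in> ell2 V"
    by (intro bounded_ops_maps[OF A_bounded] f delta_in root_in)+
  have pos: "0 < fps_conv_radius (F g)" if "g \<in> ell2 V" for g
    using radius[OF that] c by (metis ereal_less(2) order_less_le_trans)
  have "F (A f) = F (A (delta rt)) * F f"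
  proof (rule eval_fps_eqD)
    show "0 < fps_conv_radius (F (A f))" by (rule pos[OF Af])
    have "0 < min (fps_conv_radius (F (A (delta rt)))) (fps_conv_radius (F f))"
      using pos[OF Ad] pos[OF f] by simp
    then show "0 < fps_conv_radius (F (A (delta rt)) * F f)"
      by (rule order_less_le_trans[OF _ fps_conv_radius_mult])
    have "\<forall>\<^sub>F z in nhds 0. z \<in> ball (0::complex) c"
      using c by (intro eventually_nhds_in_open) auto
    then show "\<forall>\<^sub>F z in nhds 0. eval_fps (F (A f)) z = eval_fps (F (A (delta rt)) * F f) z"
    proof (rule eventually_mono)
      fix z :: complex assume "z \<in> ball 0 c"
      then have z: "cmod z < c" by simp
      have "ereal (cmod z) < fps_conv_radius (F g)" if "g \<in> ell2 V" for g
        using z radius[OF that] by (meson less_ereal.simps(1) order_less_le_trans)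
      then have "eval_fps (F (A (delta rt)) * F f) z = eval_fps (F (A (delta rt))) z * eval_fps (F f) z"
        using Ad f by (intro eval_fps_mult) auto
      then show "eval_fps (F (A f)) z = eval_fps (F (A (delta rt)) * F f) z"
        by (simp add: eval[OF z] Af Ad f inner_A_kernel[OF p f k[OF z]])
    qed
  qed
  then have "fps_nth (F (A f)) n = fps_nth (F (A (delta rt)) * F f) n" by simp
  then show ?thesis by (simp add: F_def fps_mult_nth atLeast0AtMost)
qed

text \<open>The functions whose coefficients depend only on the depth form a closed invariant subspace
  containing the indicator of the root.\<close>

lemma coef_A_delta_depth:
  assumes "u \<in> V" "v \<in> V" "dep u = dep v"
  shows "coef (A (delta rt)) u = coef (A (delta rt)) v"
proof -
  \<comment> \<open>The inner product of \<open>f\<close> with \<open>D u v\<close> is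
    \<open>coef f u - coef f v\<close>, so depending only on the depth becomes annihilation of
    \<open>G\<close>.\<close>
  define D where "D u v = (\<lambda>x. delta u x / complex_of_real (wt u) - delta v x / complex_of_real (wt v))"
    for u v
  define G where "G = {D u v |u v. u \<in> V \<and> v \<in> V \<and> dep u = dep v}"
  have D: "D u v \<in> ell2 V" if "u \<in> V" "v \<in> V" for u v
    using that by (intro ell2_finite_support[of "{u, v}"]) (auto simp: D_def delta_def)
  have inner: "ell2_inner V f (D u v) = coef f u - coef f v" if "u \<in> V" "v \<in> V" for f u v
  proof -
    have "ell2_inner V f (D u v) = (\<Sum>x\<in>{u, v}. f x * cnj (D u v x))"
      using that by (intro ell2_inner_finite_support) (auto simp: D_def delta_def)
    then show ?thesis by (cases "u = v") (auto simp: D_def delta_def coef_def)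
  qed
  have ann: "f \<in> annihilator V G \<longleftrightarrow> f \<in> ell2 V \<and> (\<forall>u\<in>V. \<forall>v\<in>V. dep u = dep v \<longrightarrow> coef f u = coef f v)"
    for f
  proof -
    have "(\<forall>g\<in>G. ell2_inner V f g = 0) \<longleftrightarrow>
        (\<forall>u\<in>V. \<forall>v\<in>V. dep u = dep v \<longrightarrow> ell2_inner V f (D u v) = 0)"
      unfolding G_def by blast
    then show ?thesis by (simp add: annihilator_def inner)
  qed
  have "delta rt \<in> annihilator V G"
    unfolding ann
  proof (intro conjI ballI impI)
    fix u v assume uv: "u \<in> V" "v \<in> V" "dep u = dep v"
    obtain p where p: "branch p" "p (dep u) = u" by (rule branch_through[OF uv(1)])
    obtain q where q: "branch q" "q (dep v) = v" by (rule branch_through[OF uv(2)])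
    \<comment> \<open>A vertex of depth 0 is the start of the branch through it, hence the
      root.\<close>
    have "u = rt \<longleftrightarrow> v = rt"
      using p q uv(3) by (metis branch_def depth_root)
    then show "coef (delta rt) u = coef (delta rt) v" by (auto simp: coef_def delta_def)
  qed (rule delta_in[OF root_in])
  moreover have "S f \<in> annihilator V G" if f: "f \<in> annihilator V G" for f
    unfolding ann
  proof (intro conjI ballI impI)
    have fV: "f \<in> ell2 V" using f by (simp add: ann)
    then show "S f \<in> ell2 V" by (rule bounded_ops_maps[OF shift_bounded])
    fix u v assume uv: "u \<in> V" "v \<in> V" "dep u = dep v"
    obtain p where p: "branch p" "p (dep u) = u" by (rule branch_through[OF uv(1)])
    obtain q where q: "branch q" "q (dep v) = v" by (rule branch_through[OF uv(2)])
    show "coef (S f) u = coef (S f) v"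
    proof (cases "dep u")
      case 0
      then show ?thesis using p q uv(3) coef_shift(1)[OF p(1) fV] coef_shift(1)[OF q(1) fV] by simp
    next
      case (Suc n)
      have "coef f (p n) = coef f (q n)"
        using f branch_in[OF p(1)] branch_in[OF q(1)] branch_depth[OF p(1)] branch_depth[OF q(1)]
        by (simp add: ann)
      moreover have "u = p (Suc n)" "v = q (Suc n)" using p q uv(3) Suc by auto
      ultimately show ?thesis using coef_shift(2)[OF p(1) fV] coef_shift(2)[OF q(1) fV] by simp
    qed
  qed
  moreover have "G \<subseteq> ell2 V" using D by (auto simp: G_def)
  ultimately have "A (delta rt) \<in> annihilator V G" by (intro A_annihilator)
  then show ?thesis using assms unfolding ann by blast
qed

text \<open>The coefficients of the formal series in powers of \<open>S\<close>; the choice of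
  vertex is immaterial by \<open>coef_A_delta_depth\<close>.\<close>

definition symbol :: "nat \<Rightarrow> complex" where
  "symbol n = coef (A (delta rt)) (SOME v. v \<in> V \<and> dep v = n)"

lemma symbol_eq: "v \<in> V \<Longrightarrow> coef (A (delta rt)) v = symbol (dep v)"
  unfolding symbol_def
  using someI[of "\<lambda>u. u \<in> V \<and> dep u = dep v" v] by (intro coef_A_delta_depth) auto

text \<open>This is the convolution formula read back through \<open>coef_shift_power\<close>: going
  up \<open>k\<close> generations in \<open>f\<close> amounts to applying \<open>S ^^ k\<close>.
  Powers beyond \<open>dep v\<close> vanish at \<open>v\<close>, so no convergence question
  arises.\<close>

lemma A_eq_formal_series:
  assumes f: "f \<in> ell2 V" and v: "v \<in> V"
  shows "A f v = (\<Sum>k\<le>dep v. symbol k * (S ^^ k) f v)"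
proof -
  obtain p where p: "branch p" "p (dep v) = v" by (rule branch_through[OF v])
  have "coef (A f) v = (\<Sum>k\<le>dep v. coef (A (delta rt)) (p k) * coef f (p (dep v - k)))"
    using coef_A_convolution[OF p(1) f, of "dep v"] p(2) by simp
  also have "\<dots> = (\<Sum>k\<le>dep v. symbol k * coef ((S ^^ k) f) v)"
  proof (rule sum.cong)
    fix k assume "k \<in> {..dep v}"
    then show "coef (A (delta rt)) (p k) * coef f (p (dep v - k)) = symbol k * coef ((S ^^ k) f) v"
      using coef_shift_power[OF p(1) f, of k "dep v"] p(2) symbol_eq[OF branch_in[OF p(1), of k]]
      by (simp add: branch_depth[OF p(1)])
  qed simp
  finally have "coef (A f) v * complex_of_real (wt v) =
      (\<Sum>k\<le>dep v. symbol k * (coef ((S ^^ k) f) v * complex_of_real (wt v)))"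
    by (simp add: sum_distrib_right mult.assoc)
  then show ?thesis by (simp add: coef_mult_wt[OF v])
qed


section \<open>Cesaro means\<close>

text \<open>The average of the first \<open>n\<close> partial sums of the formal series; the term of
  index \<open>k\<close> occurs in \<open>n - k\<close> of them.\<close>

definition cesaro :: "nat \<Rightarrow> 'a ell2_op" where
  "cesaro n = (\<lambda>f\<in>ell2 V. \<lambda>v. \<Sum>k<n. (of_nat (n - k) / of_nat n * symbol k) * (S ^^ k) f v)"

text \<open>The window consists of the \<open>n\<close> depths ending at \<open>j\<close>, cut off
  at 0 when \<open>j\<close> is small; the form \<open>j < dep v + n\<close> avoids truncated
  subtraction.\<close>

definition window :: "nat \<Rightarrow> nat \<Rightarrow> ('a \<Rightarrow> complex) \<Rightarrow> 'a \<Rightarrow> complex" where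
  "window n j f v = (if dep v \<le> j \<and> j < dep v + n then f v else 0)"

lemma window_in: "f \<in> ell2 V \<Longrightarrow> window n j f \<in> ell2 V"
  by (rule ell2_dominated) (auto simp: window_def)

text \<open>At \<open>v\<close>, the power \<open>S ^^ k\<close> sees only the ancestor at depth
  \<open>dep v - k\<close>, so the window is tested at that depth.\<close>

lemma shift_power_window:
  assumes f: "f \<in> ell2 V" and v: "v \<in> V" and k: "k \<le> dep v"
  shows "(S ^^ k) (window n j f) v =
    (if dep v - k \<le> j \<and> j < dep v - k + n then (S ^^ k) f v else 0)"
proof -
  obtain p where p: "branch p" "p (dep v) = v" by (rule branch_through[OF v])
  have "coef ((S ^^ k) (window n j f)) v =
      (if dep v - k \<le> j \<and> j < dep v - k + n then coef ((S ^^ k) f) v else 0)"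
    using coef_shift_power[OF p(1) window_in[OF f], of k n j "dep v"]
      coef_shift_power[OF p(1) f, of k "dep v"] k p(2) branch_depth[OF p(1), of "dep v - k"]
    by (auto simp: coef_def window_def)
  then show ?thesis
    using coef_mult_wt[OF v, of "(S ^^ k) (window n j f)"] coef_mult_wt[OF v, of "(S ^^ k) f"]
    by (auto split: if_splits)
qed

text \<open>Compressing \<^term>\<open>A\<close> to the functions supported on \<^term>\<open>n\<close> consecutive depths and averaging
  over the position of the window weights \<^term>\<open>S ^^ k\<close> by the number \<^term>\<open>n - k\<close> of windows
  containing two given depths at distance \<^term>\<open>k\<close>. This bounds the Cesaro means.\<close>

lemma cesaro_eq_sum_windows:
  assumes f: "f \<in> ell2 V" and v: "v \<in> V" and n: "0 < n"
  shows "of_nat n * cesaro n f v = (\<Sum>j\<in>{dep v..<dep v + n}. A (window n j f) v)"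
proof -
  let ?d = "dep v"
  let ?t = "\<lambda>k. of_nat (n - k) * (symbol k * (S ^^ k) f v)"
  have "(\<Sum>j\<in>{?d..<?d + n}. A (window n j f) v) =
      (\<Sum>j\<in>{?d..<?d + n}. \<Sum>k\<le>?d. symbol k * (if j < ?d - k + n then (S ^^ k) f v else 0))"
    by (intro sum.cong refl)
      (auto simp: A_eq_formal_series[OF window_in[OF f] v] shift_power_window[OF f v] intro!: sum.cong)
  also have "\<dots> = (\<Sum>k\<le>?d. \<Sum>j\<in>{?d..<?d + n}. symbol k * (if j < ?d - k + n then (S ^^ k) f v else 0))"
    by (rule sum.swap)
  also have "\<dots> = (\<Sum>k\<le>?d. ?t k)"
  proof (rule sum.cong)
    \<comment> \<open>The windows containing both depths \<open>?d - k\<close> and \<open>?d\<close>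
      number \<open>n - k\<close>, which is 0 for \<open>k >= n\<close> by truncated
      subtraction.\<close>
    fix k assume "k \<in> {..?d}"
    then have "{?d..<?d + n} \<inter> {j. j < ?d - k + n} = {?d..<?d - k + n}" "?d - k + n - ?d = n - k"
      by auto
    then show "(\<Sum>j\<in>{?d..<?d + n}. symbol k * (if j < ?d - k + n then (S ^^ k) f v else 0)) = ?t k"
      by (simp add: sum_distrib_left[symmetric] sum.If_cases mult_ac)
  qed simp
  \<comment> \<open>The two ranges are interchangeable: terms with \<open>k >= n\<close> have factor
    0, and for \<open>k > ?d\<close> the power \<open>S ^^ k\<close> vanishes at
    \<open>v\<close>.\<close>
  also have "\<dots> = (\<Sum>k<n. ?t k)"
    by (rule sum.mono_neutral_cong) (auto simp: shift_power_eq_0[OF f v])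
  also have "\<dots> = of_nat n * cesaro n f v"
    using n f by (simp add: cesaro_def sum_distrib_left mult.assoc)
  finally show ?thesis ..
qed

text \<open>A vertex at depth \<open>d\<close> lies only in the \<open>n\<close> windows with
  \<open>d <= j < d + n\<close>, so exchanging the sums counts its square at most \<open>n\<close>
  times.\<close>

lemma sum_window_norm_le:
  assumes f: "f \<in> ell2 V"
  shows "(\<Sum>j<J. (ell2_norm V (window n j f))\<^sup>2) \<le> real n * (ell2_norm V f)\<^sup>2"
proof -
  let ?w = "\<lambda>j v. (cmod (window n j f v))\<^sup>2"
  have w: "?w j summable_on V" for j by (intro ell2_summable window_in f)
  have sum: "((\<lambda>v. \<Sum>j<J. ?w j v) has_sum (\<Sum>j<J. (ell2_norm V (window n j f))\<^sup>2)) V" for J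
  proof (induction J)
    case (Suc J)
    have "(?w J has_sum (ell2_norm V (window n J f))\<^sup>2) V"
      unfolding ell2_norm_sq using w[of J] by simp
    from has_sum_add[OF Suc this] show ?case by simp
  qed simp
  have le: "(\<Sum>j<J. ?w j v) \<le> real n * (cmod (f v))\<^sup>2" for v
  proof -
    have "(\<Sum>j<J. ?w j v) = (\<Sum>j<J. if j \<in> {dep v..<dep v + n} then (cmod (f v))\<^sup>2 else 0)"
      by (intro sum.cong refl) (auto simp: window_def)
    also have "\<dots> = real (card ({..<J} \<inter> {dep v..<dep v + n})) * (cmod (f v))\<^sup>2"
      by (simp add: sum.If_cases del: atLeastLessThan_iff)
    also have "\<dots> \<le> real n * (cmod (f v))\<^sup>2"
      using card_mono[of "{dep v..<dep v + n}" "{..<J} \<inter> {dep v..<dep v + n}"]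
      by (intro mult_right_mono) auto
    finally show ?thesis .
  qed
  have "((\<lambda>v. real n * (cmod (f v))\<^sup>2) has_sum (real n * (ell2_norm V f)\<^sup>2)) V"
    unfolding ell2_norm_sq using ell2_summable[OF f] by (intro has_sum_cmult_right) simp
  from has_sum_mono[OF sum this] show ?thesis using le by simp
qed

lemma cesaro_in: "f \<in> ell2 V \<Longrightarrow> cesaro n f \<in> ell2 V"
  using subalgebra_polynomial[OF subalgebra_bounded_ops shift_bounded op_id_bounded, of _ n]
  unfolding cesaro_def by (rule bounded_ops_maps)

text \<open>Cauchy-Schwarz over the \<open>n\<close> windows containing a given depth costs a factor
  \<open>n\<close>, and the overlap of the windows costs another; both cancel against the square of
  the averaging factor \<open>1 / n\<close>.\<close>

lemma cesaro_norm_le: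
  assumes f: "f \<in> ell2 V" and n: "0 < n" and C: "0 \<le> C"
    and bound: "\<And>g. g \<in> ell2 V \<Longrightarrow> ell2_norm V (A g) \<le> C * ell2_norm V g"
  shows "ell2_norm V (cesaro n f) \<le> C * ell2_norm V f"
proof (rule ell2_norm_le_finite_sums[OF cesaro_in[OF f]])
  show "0 \<le> C * ell2_norm V f" by (intro mult_nonneg_nonneg C ell2_norm_nonneg)
  fix F assume F: "finite F" "F \<subseteq> V"
  \<comment> \<open>\<open>sum dep F\<close> bounds every depth in \<open>F\<close>, so all windows
    containing a vertex of \<open>F\<close> have index below \<open>J\<close>.\<close>
  define J where "J = sum dep F + n"
  let ?a = "\<lambda>j v. (cmod (A (window n j f) v))\<^sup>2"
  have J: "{dep v..<dep v + n} \<subseteq> {..<J}" if "v \<in> F" for v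
    using member_le_sum[OF that, of dep] F(1) by (auto simp: J_def)
  have "(real n)\<^sup>2 * (cmod (cesaro n f v))\<^sup>2 \<le> real n * (\<Sum>j<J. ?a j v)" if v: "v \<in> F" for v
  proof -
    have "(real n)\<^sup>2 * (cmod (cesaro n f v))\<^sup>2 = (cmod (of_nat n * cesaro n f v))\<^sup>2"
      by (simp add: norm_mult power_mult_distrib)
    also have "\<dots> = (cmod (\<Sum>j\<in>{dep v..<dep v + n}. A (window n j f) v))\<^sup>2"
      using v F by (subst cesaro_eq_sum_windows[OF f _ n]) auto
    also have "\<dots> \<le> (\<Sum>j\<in>{dep v..<dep v + n}. cmod (A (window n j f) v))\<^sup>2"
      by (intro power_mono norm_sum) simp
    also have "\<dots> \<le> (\<Sum>j\<in>{dep v..<dep v + n}. ?a j v) * real n"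
      using sum_squared_le_sum_of_squares[of "\<lambda>j. cmod (A (window n j f) v)" "{dep v..<dep v + n}"]
      by simp
    also have "\<dots> \<le> (\<Sum>j<J. ?a j v) * real n"
      using J[OF v] by (intro mult_right_mono sum_mono2) auto
    finally show ?thesis by (simp add: mult.commute)
  qed
  then have "(\<Sum>v\<in>F. (real n)\<^sup>2 * (cmod (cesaro n f v))\<^sup>2) \<le> (\<Sum>v\<in>F. real n * (\<Sum>j<J. ?a j v))"
    by (rule sum_mono)
  also have "\<dots> = real n * (\<Sum>j<J. \<Sum>v\<in>F. ?a j v)"
    by (simp add: sum_distrib_left[symmetric] sum.swap[of _ F])
  also have "\<dots> \<le> real n * (\<Sum>j<J. C\<^sup>2 * (ell2_norm V (window n j f))\<^sup>2)"
  proof (intro mult_left_mono sum_mono)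
    fix j
    have w: "window n j f \<in> ell2 V" by (rule window_in[OF f])
    have "(\<Sum>v\<in>F. ?a j v) \<le> (ell2_norm V (A (window n j f)))\<^sup>2"
      by (intro sum_le_ell2_norm_sq F bounded_ops_maps[OF A_bounded] w)
    also have "\<dots> \<le> (C * ell2_norm V (window n j f))\<^sup>2"
      by (intro power_mono bound w ell2_norm_nonneg)
    finally show "(\<Sum>v\<in>F. ?a j v) \<le> C\<^sup>2 * (ell2_norm V (window n j f))\<^sup>2"
      by (simp add: power_mult_distrib)
  qed simp
  also have "\<dots> \<le> real n * (C\<^sup>2 * (real n * (ell2_norm V f)\<^sup>2))"
    unfolding sum_distrib_left[symmetric]
    by (intro mult_left_mono sum_window_norm_le f) auto
  finally have "(real n)\<^sup>2 * (\<Sum>v\<in>F. (cmod (cesaro n f v))\<^sup>2) \<le> (real n)\<^sup>2 * (C * ell2_norm V f)\<^sup>2"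
    by (simp add: sum_distrib_left power_mult_distrib power2_eq_square mult_ac)
  then show "(\<Sum>v\<in>F. (cmod (cesaro n f v))\<^sup>2) \<le> (C * ell2_norm V f)\<^sup>2"
    using n by simp
qed

text \<open>Once \<open>n\<close> reaches \<open>dep v\<close>, the mean at \<open>v\<close> has a
  fixed finite set of terms, whose weights \<open>1 - k / (n + 1)\<close> tend to 1.\<close>

lemma cesaro_tendsto:
  assumes f: "f \<in> ell2 V" and v: "v \<in> V"
  shows "(\<lambda>n. cesaro (Suc n) f v) \<longlonglongrightarrow> A f v"
proof -
  let ?d = "dep v"
  have eq: "cesaro (Suc n) f v =
      (\<Sum>k\<le>?d. (1 - of_nat k / of_nat (Suc n)) * (symbol k * (S ^^ k) f v))" if "n \<ge> ?d" for n
  proof -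
    have "cesaro (Suc n) f v =
        (\<Sum>k<Suc n. (of_nat (Suc n - k) / of_nat (Suc n) * symbol k) * (S ^^ k) f v)"
      using f by (simp add: cesaro_def)
    also have "\<dots> = (\<Sum>k\<le>?d. (of_nat (Suc n - k) / of_nat (Suc n) * symbol k) * (S ^^ k) f v)"
      using that by (intro sum.mono_neutral_right) (auto simp: shift_power_eq_0[OF f v])
    also have "\<dots> = (\<Sum>k\<le>?d. (1 - of_nat k / of_nat (Suc n)) * (symbol k * (S ^^ k) f v))"
    proof (rule sum.cong)
      fix k assume "k \<in> {..?d}"
      then have "(of_nat (Suc n - k) :: complex) / of_nat (Suc n) = 1 - of_nat k / of_nat (Suc n)"
        using that by (simp add: of_nat_diff diff_divide_distrib del: of_nat_Suc)
      then show "(of_nat (Suc n - k) / of_nat (Suc n) * symbol k) * (S ^^ k) f v =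
          (1 - of_nat k / of_nat (Suc n)) * (symbol k * (S ^^ k) f v)"
        by (simp only: mult.assoc)
    qed simp
    finally show ?thesis .
  qed
  have ev: "\<forall>\<^sub>F n in sequentially. (\<Sum>k\<le>?d. (1 - of_nat k / of_nat (Suc n)) * (symbol k * (S ^^ k) f v))
      = cesaro (Suc n) f v"
    by (rule eventually_sequentiallyI[of ?d]) (rule eq[symmetric])
  have "(\<lambda>n. \<Sum>k\<le>?d. (1 - of_nat k / of_nat (Suc n)) * (symbol k * (S ^^ k) f v)) \<longlonglongrightarrow>
      (\<Sum>k\<le>?d. (1 - 0) * (symbol k * (S ^^ k) f v))"
    by (intro tendsto_intros LIMSEQ_Suc[OF lim_const_over_n])
  then have "(\<lambda>n. cesaro (Suc n) f v) \<longlonglongrightarrow> (\<Sum>k\<le>?d. (1 - 0) * (symbol k * (S ^^ k) f v))"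
    by (rule Lim_transform_eventually[OF _ ev])
  then show ?thesis by (simp add: A_eq_formal_series[OF f v])
qed

text \<open>Every competing algebra contains the Cesaro means, which are polynomials in
  \<open>S\<close>. Uniformly bounded and pointwise convergent, they converge weakly to
  \<open>A\<close>, and closedness yields membership.\<close>

lemma A_in_generated: "A \<in> generated_wot_algebra V S"
  unfolding generated_wot_algebra_def
proof (rule InterI, clarify)
  fix W assume W: "subalgebra V W" "S \<in> W" "op_id V \<in> W" "closedin (wot V) W"
  obtain C where C: "0 \<le> C" "\<And>f. f \<in> ell2 V \<Longrightarrow> ell2_norm V (A f) \<le> C * ell2_norm V f"
    using bounded_ops_bound[OF A_bounded] by metis
  show "A \<in> W"
  proof (rule closedin_wot_sequence[OF W(4) _ A_bounded])
    show "cesaro (Suc n) \<in> W" for n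
      unfolding cesaro_def by (rule subalgebra_polynomial[OF W(1-3)])
    fix f g assume f: "f \<in> ell2 V" and g: "g \<in> ell2 V"
    show "(\<lambda>n. ell2_inner V (cesaro (Suc n) f) g) \<longlonglongrightarrow> ell2_inner V (A f) g"
      by (rule ell2_weak_convergence[OF cesaro_in[OF f] bounded_ops_maps[OF A_bounded f] g
            cesaro_norm_le[OF f _ C] cesaro_tendsto[OF f]]) simp_all
  qed
qed

end

lemma reflexive_shift: "reflexive_op V S"
  unfolding reflexive_op_def reflexive_algebra_def
proof
  show "Alg V (Lat V (generated_wot_algebra V S)) \<subseteq> generated_wot_algebra V S"
    using A_in_generated by blast
  \<comment> \<open>This inclusion holds for every set of bounded operators.\<close>
  show "generated_wot_algebra V S \<subseteq> Alg V (Lat V (generated_wot_algebra V S))"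
    using generated_wot_algebra_bounded[OF shift_bounded] by (auto simp: Alg_def Lat_def)
qed

end

theorem theorem10:
  fixes V :: "'a set" and E :: "('a \<times> 'a) set" and lam :: "'a \<Rightarrow> real"
  assumes "directed_tree V E" and "rooted V E" and "leafless V E"
    and "countable V" and "infinite V"
    and "\<forall>v \<in> V - {tree_root V E}. lam v > 0"
    and "weighted_shift V E lam \<in> bounded_ops V"
    and "\<forall>VP EP. tree_path V E VP EP \<longrightarrow> r2_path V E lam VP > 0"
  shows "reflexive_op V (weighted_shift V E lam)"
proof -
  interpret weighted_tree V E lam
    by standard (use assms in auto)
  show ?thesis by (rule reflexive_shift)
qed

end
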